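(* Let $2\le p\le\infty$, $n\ge 2$ and $0<T<\infty$. Let $f:\mathbb{R}^n\to\mathbb{R}$ satisfy $0<\inf_{\mathbb{R}^n}f\le\sup_{\mathbb{R}^n}f<\infty$. Suppose that $u\in C\big((\mathbb{R}^n\times\{0\})\cup(\mathbb{R}^n\times(0,T))\big)$, $u>0$, is a viscosity solution of $$\Gamma_p u=0\ \text{ in }\mathbb{R}^n\times(0,T),\qquad u(x,0)=f(x)\ \ \forall x\in\mathbb{R}^n,$$ and that, as $R\to\infty$, $$\sup_{0\le|x|\le R,\ 0\le t<T}u(x,t)\le\begin{cases}\exp\big(o(R^{p/(p-1)})\big), & 2\le p<\infty,\\ \exp\big(o(R^{4/3})\big), & p=\infty.\end{cases}$$ Then $\inf_{\mathbb{R}^n}f\le u(x,t)\le\sup_{\mathbb{R}^n}f$ for all $(x,t)\in\mathbb{R}^n\times(0,T)$.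
   Context: Here $p=\infty$ is a label. For $2\le p<\infty$, $\Delta_p w=\mathrm{div}(|Dw|^{p-2}Dw)$ and $\Gamma_p u=\Delta_p u-(p-1)u^{p-2}u_t$; for $p=\infty$, $\Delta_\infty w=\sum_{i,j=1}^n D_iw\,D_jw\,D_{ij}w$ and $\Gamma_\infty u=\Delta_\infty u-3u^2u_t$ (spatial derivatives in $x$ only). For a $C^2$ function $\psi$ of $x$ and $p<\infty$, $\Delta_p\psi=|D\psi|^{p-2}\Delta\psi+(p-2)|D\psi|^{p-4}\Delta_\infty\psi$ where $D\psi\ne0$; for $p>2$ it is $0$ where $D\psi=0$; for $p=2$ it is $\Delta\psi$. Viscosity solutions: a positive upper semi-continuous $u$ satisfies $\Gamma_p u\ge0$ in $\mathbb{R}^n\times(0,T)$ if for every $\psi(x,t)$, $C^2$ in $x$ and $C^1$ in $t$, such that $u-\psi$ has a local maximum at $(y,s)\in\mathbb{R}^n\times(0,T)$, one has $\Delta_p\psi(y,s)-(p-1)u(y,s)^{p-2}\psi_t(y,s)\ge0$ when $p<\infty$, respectively $\Delta_\infty\psi(y,s)-3u(y,s)^2\psi_t(y,s)\ge0$ when $p=\infty$. A positive lower semi-continuous $u$ satisfies $\Gamma_pu\le0$ if the reversed inequalities hold whenever $u-\psi$ has a local minimum at $(y,s)$. A continuous $u>0$ satisfies $\Gamma_pu=0$ if both hold. *)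

theory Defs
  imports "HOL-Analysis.Analysis" "HOL-Library.Landau_Symbols"
begin

section \<open>Spatial differential operators\<close>

definition has_partial :: "'n::finite \<Rightarrow> (real^'n \<Rightarrow> real) \<Rightarrow> real^'n \<Rightarrow> bool" where
  "has_partial i w x \<longleftrightarrow> (\<lambda>h. w (x + h *\<^sub>R axis i 1)) field_differentiable (at 0)"

definition partial :: "'n::finite \<Rightarrow> (real^'n \<Rightarrow> real) \<Rightarrow> real^'n \<Rightarrow> real" where
  "partial i w x = deriv (\<lambda>h. w (x + h *\<^sub>R axis i 1)) 0"

definition grad :: "(real^'n::finite \<Rightarrow> real) \<Rightarrow> real^'n \<Rightarrow> real^'n" where
  "grad w x = (\<chi> i. partial i w x)"

definition laplacian :: "(real^'n::finite \<Rightarrow> real) \<Rightarrow> real^'n \<Rightarrow> real" where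
  "laplacian w x = (\<Sum>i\<in>UNIV. partial i (partial i w) x)"

definition infinity_laplacian :: "(real^'n::finite \<Rightarrow> real) \<Rightarrow> real^'n \<Rightarrow> real" where
  "infinity_laplacian w x =
     (\<Sum>i\<in>UNIV. \<Sum>j\<in>UNIV. partial i w x * partial j w x * partial i (partial j w) x)"

text \<open>The operator div(|Dw|^(p-2) Dw) in expanded form, for \<open>2 \<le> p < \<infinity>\<close> and w of class C^2.
  For \<open>p > 2\<close> it vanishes where the gradient does.\<close>

definition p_laplacian :: "real \<Rightarrow> (real^'n::finite \<Rightarrow> real) \<Rightarrow> real^'n \<Rightarrow> real" where
  "p_laplacian p w x =
     (if grad w x \<noteq> 0
      then norm (grad w x) powr (p - 2) * laplacian w x
           + (p - 2) * norm (grad w x) powr (p - 4) * infinity_laplacian w x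
      else if p = 2 then laplacian w x else 0)"


section \<open>Test functions\<close>

text \<open>C^2 in x and C^1 in t: the function and the derivatives \<open>D\<^sub>i\<close>, \<open>D\<^sub>i D\<^sub>j\<close> and \<open>d/dt\<close>
  exist and are jointly continuous in \<open>(x, t)\<close>. Used for open \<open>\<Omega>\<close> only.\<close>

definition C21_on :: "((real^'n::finite) \<times> real) set \<Rightarrow> ((real^'n) \<times> real \<Rightarrow> real) \<Rightarrow> bool" where
  "C21_on \<Omega> \<psi> \<longleftrightarrow>
     continuous_on \<Omega> \<psi> \<and>
     (\<forall>i. (\<forall>(x, t)\<in>\<Omega>. has_partial i (\<lambda>z. \<psi> (z, t)) x) \<and>
          continuous_on \<Omega> (\<lambda>(x, t). partial i (\<lambda>z. \<psi> (z, t)) x)) \<and>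
     (\<forall>i j. (\<forall>(x, t)\<in>\<Omega>. has_partial i (partial j (\<lambda>z. \<psi> (z, t))) x) \<and>
          continuous_on \<Omega> (\<lambda>(x, t). partial i (partial j (\<lambda>z. \<psi> (z, t))) x)) \<and>
     (\<forall>(x, t)\<in>\<Omega>. (\<lambda>s. \<psi> (x, s)) field_differentiable (at t)) \<and>
     continuous_on \<Omega> (\<lambda>(x, t). deriv (\<lambda>s. \<psi> (x, s)) t)"


section \<open>Viscosity solutions\<close>

text \<open>The expression tested at \<open>(y, s)\<close>: the derivatives are those of the test function \<open>\<psi>\<close>, while
  \<open>a\<close> stands for the value \<open>u (y, s)\<close> of the solution. The exponent \<open>p\<close> ranges over
  \<open>2 \<le> p \<le> \<infinity>\<close>, with \<open>\<infinity>\<close> serving as a label.\<close>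

definition Gamma_test ::
  "ereal \<Rightarrow> real \<Rightarrow> ((real^'n::finite) \<times> real \<Rightarrow> real) \<Rightarrow> real^'n \<Rightarrow> real \<Rightarrow> real" where
  "Gamma_test p a \<psi> y s =
     (if p = \<infinity>
      then infinity_laplacian (\<lambda>x. \<psi> (x, s)) y - 3 * a\<^sup>2 * deriv (\<lambda>t. \<psi> (y, t)) s
      else p_laplacian (real_of_ereal p) (\<lambda>x. \<psi> (x, s)) y
           - (real_of_ereal p - 1) * a powr (real_of_ereal p - 2) * deriv (\<lambda>t. \<psi> (y, t)) s)"

definition usc_on :: "'a::topological_space set \<Rightarrow> ('a \<Rightarrow> real) \<Rightarrow> bool" where
  "usc_on S u \<longleftrightarrow> (\<forall>x\<in>S. \<forall>c>u x. \<forall>\<^sub>F y in at x within S. u y < c)"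

definition lsc_on :: "'a::topological_space set \<Rightarrow> ('a \<Rightarrow> real) \<Rightarrow> bool" where
  "lsc_on S u \<longleftrightarrow> (\<forall>x\<in>S. \<forall>c<u x. \<forall>\<^sub>F y in at x within S. c < u y)"

definition local_max_at :: "('a::topological_space \<Rightarrow> real) \<Rightarrow> 'a \<Rightarrow> bool" where
  "local_max_at g z \<longleftrightarrow> (\<forall>\<^sub>F w in nhds z. g w \<le> g z)"

definition local_min_at :: "('a::topological_space \<Rightarrow> real) \<Rightarrow> 'a \<Rightarrow> bool" where
  "local_min_at g z \<longleftrightarrow> (\<forall>\<^sub>F w in nhds z. g z \<le> g w)"

abbreviation cylinder :: "real \<Rightarrow> ((real^'n::finite) \<times> real) set" where
  "cylinder T \<equiv> UNIV \<times> {0<..<T}"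

definition viscosity_subsolution ::
  "ereal \<Rightarrow> real \<Rightarrow> ((real^'n::finite) \<times> real \<Rightarrow> real) \<Rightarrow> bool" where
  "viscosity_subsolution p T u \<longleftrightarrow>
     usc_on (cylinder T) u \<and> (\<forall>z\<in>cylinder T. 0 < u z) \<and>
     (\<forall>\<psi> y s. C21_on (cylinder T) \<psi> \<longrightarrow> (y, s) \<in> cylinder T \<longrightarrow>
        local_max_at (\<lambda>z. u z - \<psi> z) (y, s) \<longrightarrow> Gamma_test p (u (y, s)) \<psi> y s \<ge> 0)"

definition viscosity_supersolution ::
  "ereal \<Rightarrow> real \<Rightarrow> ((real^'n::finite) \<times> real \<Rightarrow> real) \<Rightarrow> bool" where
  "viscosity_supersolution p T u \<longleftrightarrow>
     lsc_on (cylinder T) u \<and> (\<forall>z\<in>cylinder T. 0 < u z) \<and>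
     (\<forall>\<psi> y s. C21_on (cylinder T) \<psi> \<longrightarrow> (y, s) \<in> cylinder T \<longrightarrow>
        local_min_at (\<lambda>z. u z - \<psi> z) (y, s) \<longrightarrow> Gamma_test p (u (y, s)) \<psi> y s \<le> 0)"

definition viscosity_solution ::
  "ereal \<Rightarrow> real \<Rightarrow> ((real^'n::finite) \<times> real \<Rightarrow> real) \<Rightarrow> bool" where
  "viscosity_solution p T u \<longleftrightarrow>
     continuous_on (cylinder T) u \<and> (\<forall>z\<in>cylinder T. 0 < u z) \<and>
     viscosity_subsolution p T u \<and> viscosity_supersolution p T u"

definition growth_exponent :: "ereal \<Rightarrow> real" where
  "growth_exponent p =
     (if p = \<infinity> then 4 / 3 else real_of_ereal p / (real_of_ereal p - 1))"

end

theory Submission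
  imports Defs
begin

text \<open>
  The equation is invariant under multiplication of \<open>u\<close> by positive constants, and \<open>v = ln u\<close> solves
  \<open>(P - 1) v\<^sub>t = \<Delta>\<^sub>P v + (P - 1)|Dv|\<^bsup>P\<^esup>\<close>, with \<open>P = p\<close> for finite \<open>p\<close>; for \<open>p = \<infinity>\<close> it is
  \<open>3 v\<^sub>t = \<Delta>\<^sub>\<infinity> v + |Dv|\<^sup>4\<close>, which has the scaling of \<open>P = 4\<close>. Both bounds follow by comparing \<open>u\<close> with
  explicit smooth strict barriers on bounded cylinders. Since one of the two functions is
  smooth, the barrier itself, rescaled, serves as test function.

  For the upper bound let \<open>q = P/(P - 1)\<close>. A function \<open>v\<close> of size \<open>\<epsilon>|x|\<^bsup>q\<^esup>\<close> has
  \<open>|Dv|\<^bsup>P\<^esup>\<close> of size \<open>\<epsilon>\<^bsup>P\<^esup>|x|\<^bsup>q\<^esup>\<close> and \<open>\<Delta>\<^sub>P v\<close> bounded by a multiple of \<open>\<epsilon>\<^bsup>P-1\<^esup>\<close>. As \<open>P \<ge> 2\<close>, the function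
  \<open>ln M + \<epsilon>((1 + t)(1 + |x|\<^sup>2)\<^bsup>q/2\<^esup> + K t)\<close> is therefore a strict supersolution for all small \<open>\<epsilon>\<close>, where
  \<open>M\<close> is the supremum of \<open>f\<close>. The growth condition \<open>ln u \<le> o(R\<^bsup>q\<^esup>)\<close> places it above \<open>v\<close> on the
  boundary of a large ball, and letting \<open>\<epsilon>\<close> tend to 0 gives \<open>u \<le> M\<close>
  (\<open>growth_barrier_strict\<close>, \<open>subsolution_upper_bound\<close>).

  For the lower bound the barrier is \<open>m (1 - |x|\<^sup>2/R\<^sup>2)\<^sup>2 exp(-K t/R\<^sup>2)\<close> on the ball of radius \<open>R\<close>, where \<open>m\<close>
  is the infimum of \<open>f\<close>. It vanishes on the lateral boundary, where \<open>u > 0\<close>, and for a suitable \<open>K\<close>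
  independent of \<open>R\<close> it is a strict subsolution; then \<open>R\<close> tends to infinity
  (\<open>radial_Gamma_bump_pos\<close>, \<open>supersolution_lower_bound\<close>).

  All barriers are functions of \<open>|x|\<^sup>2\<close> and \<open>t\<close>, for which the tested expression reduces to a formula
  in one spatial variable (\<open>Gamma_test_radial\<close>).
\<close>

section \<open>Radial test functions\<close>

text \<open>Writing radial functions as \<open>G(|x|\<^sup>2)\<close> rather than \<open>g(|x|)\<close> keeps them smooth at the origin.\<close>

lemma radial_directional_derivative:
  fixes x :: "real^'n::finite"
  assumes "(G has_field_derivative G') (at (x \<bullet> x))"
  shows "((\<lambda>h. G ((x + h *\<^sub>R axis i 1) \<bullet> (x + h *\<^sub>R axis i 1))) has_field_derivative 2 * x $ i * G') (at 0)"
proof -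
  have e: "(x + h *\<^sub>R axis i 1) \<bullet> (x + h *\<^sub>R axis i 1) = x \<bullet> x + 2 * h * x $ i + h\<^sup>2" for h :: real
    by (simp add: inner_add_left inner_add_right inner_axis inner_axis' power2_eq_square algebra_simps)
  have "((\<lambda>h. x \<bullet> x + 2 * h * x $ i + h\<^sup>2) has_field_derivative 2 * x $ i) (at 0)"
    by (auto intro!: derivative_eq_intros)
  from DERIV_chain'[OF this, of G G'] assms show ?thesis
    unfolding e by (simp add: mult.commute)
qed

lemma
  fixes x :: "real^'n::finite"
  assumes "(G has_field_derivative G') (at (x \<bullet> x))"
  shows has_partial_radial: "has_partial i (\<lambda>z. G (z \<bullet> z)) x"
    and partial_radial: "partial i (\<lambda>z. G (z \<bullet> z)) x = 2 * x $ i * G'"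
  using radial_directional_derivative[OF assms, of i] unfolding has_partial_def partial_def
  by (auto simp: field_differentiable_def dest: DERIV_imp_deriv)

text \<open>Profiles are differentiated on \<open>s > -1\<close>, an open set containing all values of \<open>|x|\<^sup>2\<close> on which
  \<open>(1 + s)\<^bsup>\<gamma>\<^esup>\<close> is smooth.\<close>

lemma inner_gt_minus_one: "-1 < (x :: real^'n::finite) \<bullet> x"
  by (rule less_le_trans[of _ 0]) auto

context
  fixes G G1 G2 :: "real \<Rightarrow> real"
  assumes G1: "\<And>s. -1 < s \<Longrightarrow> (G has_field_derivative G1 s) (at s)"
    and G2: "\<And>s. -1 < s \<Longrightarrow> (G1 has_field_derivative G2 s) (at s)"
begin

lemma partial_radial_fun:
  "partial j (\<lambda>z :: real^'n::finite. G (z \<bullet> z)) = (\<lambda>z. 2 * z $ j * G1 (z \<bullet> z))"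
  by (rule ext, rule partial_radial[OF G1[OF inner_gt_minus_one]])

lemma second_directional_derivative:
  fixes x :: "real^'n::finite"
  shows "((\<lambda>h. partial j (\<lambda>z. G (z \<bullet> z)) (x + h *\<^sub>R axis i 1)) has_field_derivative
           4 * x $ i * x $ j * G2 (x \<bullet> x) + (if i = j then 2 * G1 (x \<bullet> x) else 0)) (at 0)"
proof -
  have "((\<lambda>h. 2 * (x + h *\<^sub>R axis i 1) $ j) has_field_derivative (if i = j then 2 else 0)) (at 0)"
    by (cases "i = j") (auto simp: axis_def intro!: derivative_eq_intros)
  from DERIV_mult[OF this radial_directional_derivative[OF G2[OF inner_gt_minus_one]]]
  show ?thesis
    unfolding partial_radial_fun by (cases "i = j") (auto simp: algebra_simps)
qed

lemma
  fixes x :: "real^'n::finite"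
  shows has_partial2_radial: "has_partial i (partial j (\<lambda>z. G (z \<bullet> z))) x"
    and partial2_radial: "partial i (partial j (\<lambda>z. G (z \<bullet> z))) x
      = 4 * x $ i * x $ j * G2 (x \<bullet> x) + (if i = j then 2 * G1 (x \<bullet> x) else 0)"
  using second_directional_derivative[of j x i] unfolding has_partial_def partial_def[of i]
  by (auto simp: field_differentiable_def dest: DERIV_imp_deriv)

lemma grad_radial: "grad (\<lambda>z :: real^'n::finite. G (z \<bullet> z)) x = (2 * G1 (x \<bullet> x)) *\<^sub>R x"
  by (simp add: grad_def partial_radial_fun vec_eq_iff)

lemma laplacian_radial:
  "laplacian (\<lambda>z :: real^'n::finite. G (z \<bullet> z)) x
     = 4 * (x \<bullet> x) * G2 (x \<bullet> x) + 2 * CARD('n) * G1 (x \<bullet> x)"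
proof -
  have "laplacian (\<lambda>z :: real^'n. G (z \<bullet> z)) x
      = (\<Sum>i\<in>UNIV. 4 * G2 (x \<bullet> x) * (x $ i * x $ i) + 2 * G1 (x \<bullet> x))"
    unfolding laplacian_def partial2_radial by (simp add: algebra_simps)
  also have "\<dots> = 4 * G2 (x \<bullet> x) * (\<Sum>i\<in>UNIV. x $ i * x $ i) + 2 * CARD('n) * G1 (x \<bullet> x)"
    by (simp add: sum.distrib sum_distrib_left)
  also have "(\<Sum>i\<in>UNIV. x $ i * x $ i) = x \<bullet> x"
    by (simp add: inner_vec_def)
  finally show ?thesis by (simp add: algebra_simps)
qed

lemma infinity_laplacian_radial:
  "infinity_laplacian (\<lambda>z :: real^'n::finite. G (z \<bullet> z)) x
     = (norm (grad (\<lambda>z :: real^'n::finite. G (z \<bullet> z)) x))\<^sup>2 * (4 * (x \<bullet> x) * G2 (x \<bullet> x) + 2 * G1 (x \<bullet> x))"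
proof -
  let ?a = "G1 (x \<bullet> x)" and ?b = "G2 (x \<bullet> x)"
  have sq: "x \<bullet> x = (\<Sum>i\<in>UNIV. x $ i * x $ i)" by (simp add: inner_vec_def)
  have "infinity_laplacian (\<lambda>z. G (z \<bullet> z)) x
    = (\<Sum>i\<in>UNIV. \<Sum>j\<in>UNIV. 16 * ?a\<^sup>2 * ?b * ((x $ i * x $ i) * (x $ j * x $ j))
         + (if i = j then 8 * ?a^3 * (x $ i * x $ j) else 0))"
    unfolding infinity_laplacian_def partial2_radial
    by (intro sum.cong refl) (simp add: partial_radial_fun algebra_simps power2_eq_square power3_eq_cube)
  also have "\<dots> = 16 * ?a\<^sup>2 * ?b * (x \<bullet> x)\<^sup>2 + 8 * ?a^3 * (x \<bullet> x)"
    unfolding sq power2_eq_square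
    by (simp add: sum.distrib sum_product flip: sum_distrib_left)
  also have "\<dots> = (4 * ?a\<^sup>2 * (x \<bullet> x)) * (4 * (x \<bullet> x) * ?b + 2 * ?a)"
    by (simp add: algebra_simps power2_eq_square power3_eq_cube)
  finally show ?thesis
    by (simp add: grad_radial power_mult_distrib power2_norm_eq_inner)
qed

end

section \<open>The equation on radial functions\<close>

text \<open>The factor \<open>|D\<psi>|\<^bsup>p-2\<^esup>\<close> with the convention \<open>0\<^bsup>0\<^esup> = 1\<close>, whereas \<open>0 powr 0 = 0\<close>: with it a single formula
  covers critical points of the test function, both for \<open>p = 2\<close>, where the Laplacian survives, and
  for \<open>p > 2\<close>, where the operator vanishes.\<close>

definition weight :: "real \<Rightarrow> real \<Rightarrow> real" where
  "weight m g = (if m = 0 then 1 else g powr m)"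

text \<open>On radial functions the operator with the label \<open>p = \<infinity>\<close> has the same shape as the one for
  \<open>p = 4\<close>: it is homogeneous of degree 3, its time coefficient is \<open>3 = 4 - 1\<close>, and its growth
  exponent is \<open>4/3 = 4/(4 - 1)\<close>. The number below replaces \<open>p\<close> in all exponents.\<close>

definition eff_exponent :: "ereal \<Rightarrow> real" where
  "eff_exponent p = (if p = \<infinity> then 4 else real_of_ereal p)"

text \<open>The numbers \<open>A\<close> and \<open>B\<close> such that the spatial operator applied to \<open>G(|x|\<^sup>2)\<close> is
  \<open>|D\<psi>|\<^bsup>P-2\<^esup> (4 A s G'' + 2 B G')\<close> at \<open>s = |x|\<^sup>2\<close>, where \<open>P\<close> is the effective exponent.\<close>

definition coeff_second :: "ereal \<Rightarrow> real" where
  "coeff_second p = (if p = \<infinity> then 1 else real_of_ereal p - 1)"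

definition coeff_first :: "'n itself \<Rightarrow> ereal \<Rightarrow> real" where
  "coeff_first _ p = (if p = \<infinity> then 1 else real CARD('n) + real_of_ereal p - 2)"

lemma real_of_ereal_ge_2: "2 \<le> p \<Longrightarrow> p \<noteq> \<infinity> \<Longrightarrow> 2 \<le> real_of_ereal p"
  by (cases p) auto

lemma growth_exponent_eq_eff_exponent: "growth_exponent p = eff_exponent p / (eff_exponent p - 1)"
  by (simp add: growth_exponent_def eff_exponent_def)

lemma eff_exponent_ge_2: "2 \<le> p \<Longrightarrow> 2 \<le> eff_exponent p"
  by (simp add: eff_exponent_def real_of_ereal_ge_2)

lemma coeff_second_pos: "2 \<le> p \<Longrightarrow> 0 < coeff_second p"
  using real_of_ereal_ge_2[of p] by (auto simp: coeff_second_def)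

lemma coeff_first_pos: "2 \<le> p \<Longrightarrow> 0 < coeff_first (n :: 'n::finite itself) p"
  using real_of_ereal_ge_2[of p] zero_less_card_finite[where 'a='n]
  by (auto simp: coeff_first_def simp del: zero_less_card_finite intro: add_pos_nonneg)

text \<open>The tested expression for a test function that depends only on \<open>s = |x|\<^sup>2\<close> and \<open>t\<close>, in terms of
  its derivatives \<open>G1\<close>, \<open>G2\<close> in \<open>s\<close> and \<open>Gt\<close> in \<open>t\<close>.\<close>

definition radial_Gamma ::
  "'n itself \<Rightarrow> ereal \<Rightarrow> real \<Rightarrow> real \<Rightarrow> real \<Rightarrow> real \<Rightarrow> real \<Rightarrow> real" where
  "radial_Gamma n p s a G1 G2 Gt =
     weight (eff_exponent p - 2) (2 * \<bar>G1\<bar> * sqrt s) * (4 * coeff_second p * s * G2 + 2 * coeff_first n p * G1)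
       - (eff_exponent p - 1) * a powr (eff_exponent p - 2) * Gt"

text \<open>Both \<open>\<Delta>\<^sub>\<infinity>\<close> and the second term of \<open>\<Delta>\<^sub>p\<close> contain \<open>|D\<psi>|\<^sup>2\<close> times the second derivative in the
  radial direction, so the powers of the gradient combine. For \<open>p = \<infinity>\<close> only the radial second
  derivative is left, which is why the dimension disappears from the coefficients.\<close>

lemma Gamma_test_radial:
  fixes F F1 F2 :: "real \<Rightarrow> real \<Rightarrow> real" and y :: "real^'n::finite"
  assumes p: "2 \<le> p" and a: "0 < a"
    and F1: "\<And>s. -1 < s \<Longrightarrow> ((\<lambda>s. F s t) has_field_derivative F1 s t) (at s)"
    and F2: "\<And>s. -1 < s \<Longrightarrow> ((\<lambda>s. F1 s t) has_field_derivative F2 s t) (at s)"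
    and Ft: "((\<lambda>t. F (y \<bullet> y) t) has_field_derivative Ft) (at t)"
  shows "Gamma_test p a (\<lambda>(x, t). F (x \<bullet> x) t) y t
      = radial_Gamma TYPE('n) p (y \<bullet> y) a (F1 (y \<bullet> y) t) (F2 (y \<bullet> y) t) Ft"
proof -
  let ?w = "\<lambda>x :: real^'n. F (x \<bullet> x) t" and ?s = "y \<bullet> y"
  let ?G1 = "F1 ?s t" and ?G2 = "F2 ?s t"
  note rads = grad_radial[OF F1 F2] laplacian_radial[OF F1 F2]
  have ng: "norm (grad ?w y) = 2 * \<bar>?G1\<bar> * sqrt ?s"
    by (simp add: rads del: norm_eq_zero) (simp add: abs_mult norm_eq_sqrt_inner[of y])
  have dt: "deriv (\<lambda>t. F ?s t) t = Ft" by (rule DERIV_imp_deriv[OF Ft])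
  show ?thesis
  proof (cases "p = \<infinity>")
    case True
    have "weight 2 (2 * \<bar>?G1\<bar> * sqrt ?s) = (norm (grad ?w y))\<^sup>2"
      unfolding ng by (simp add: weight_def)
    then show ?thesis using True a
      by (simp add: Gamma_test_def radial_Gamma_def eff_exponent_def coeff_first_def coeff_second_def dt
          infinity_laplacian_radial[OF F1 F2])
  next
    case False
    define r where "r = real_of_ereal p"
    have r: "2 \<le> r" using real_of_ereal_ge_2[OF p False] r_def by simp
    have "p_laplacian r ?w y
        = weight (r - 2) (norm (grad ?w y)) * (4 * (r - 1) * ?s * ?G2 + 2 * (real CARD('n) + r - 2) * ?G1)"
    proof (cases "grad ?w y = 0")
      case True
      then have "?G1 = 0 \<or> y = 0" by (simp add: rads)
      then show ?thesis using True r
        by (auto simp: p_laplacian_def weight_def rads)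
    next
      case False
      let ?g = "norm (grad ?w y)"
      have g: "?g > 0" using False by simp
      have e: "?g powr (r - 4) * ?g\<^sup>2 = ?g powr (r - 2)"
        using g by (simp flip: powr_numeral powr_add)
      have "p_laplacian r ?w y = ?g powr (r - 2) * (4 * ?s * ?G2 + 2 * CARD('n) * ?G1)
          + (r - 2) * (?g powr (r - 4) * ?g\<^sup>2) * (4 * ?s * ?G2 + 2 * ?G1)"
        using False by (simp add: p_laplacian_def laplacian_radial[OF F1 F2]
            infinity_laplacian_radial[OF F1 F2] del: norm_scaleR)
      also have "\<dots> = ?g powr (r - 2) * (4 * (r - 1) * ?s * ?G2 + 2 * (real CARD('n) + r - 2) * ?G1)"
        unfolding e by (simp add: algebra_simps)
      also have "?g powr (r - 2) = weight (r - 2) ?g"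
        using g by (simp add: weight_def)
      finally show ?thesis .
    qed
    then show ?thesis using False
      by (simp add: Gamma_test_def radial_Gamma_def eff_exponent_def coeff_first_def coeff_second_def dt ng flip: r_def)
  qed
qed

lemma C21_on_radial:
  fixes F F1 F2 Ft :: "real \<Rightarrow> real \<Rightarrow> real"
  assumes F1: "\<And>s t. -1 < s \<Longrightarrow> ((\<lambda>s. F s t) has_field_derivative F1 s t) (at s)"
    and F2: "\<And>s t. -1 < s \<Longrightarrow> ((\<lambda>s. F1 s t) has_field_derivative F2 s t) (at s)"
    and Ft: "\<And>s t. -1 < s \<Longrightarrow> ((\<lambda>t. F s t) has_field_derivative Ft s t) (at t)"
    and cont: "continuous_on ({0..} \<times> UNIV) (\<lambda>(s, t). F s t)"
      "continuous_on ({0..} \<times> UNIV) (\<lambda>(s, t). F1 s t)"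
      "continuous_on ({0..} \<times> UNIV) (\<lambda>(s, t). F2 s t)"
      "continuous_on ({0..} \<times> UNIV) (\<lambda>(s, t). Ft s t)"
  shows "C21_on \<Omega> (\<lambda>(x :: real^'n::finite, t). F (x \<bullet> x) t)"
proof -
  have c: "continuous_on \<Omega> (\<lambda>(x :: real^'n, t). H (x \<bullet> x) t)"
    if "continuous_on ({0..} \<times> UNIV) (\<lambda>(s, t). H s t)" for H :: "real \<Rightarrow> real \<Rightarrow> real"
    unfolding case_prod_beta
    using continuous_on_compose2[OF that, of \<Omega> "\<lambda>z. (fst z \<bullet> fst z, snd z)"]
    by (fastforce simp: case_prod_beta intro: continuous_on_Pair continuous_on_inner
        continuous_on_fst continuous_on_snd continuous_on_id)
  have c': "continuous_on \<Omega> (\<lambda>z. H (fst z \<bullet> fst z) (snd z))"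
    if "continuous_on ({0..} \<times> UNIV) (\<lambda>(s, t). H s t)" for H :: "real \<Rightarrow> real \<Rightarrow> real"
    using c[OF that] by (simp add: case_prod_beta)
  have if_cont: "continuous_on \<Omega> (\<lambda>z. if b then H z else 0)"
    if "continuous_on \<Omega> H" for b and H :: "(real^'n) \<times> real \<Rightarrow> real"
    using that by (cases b) auto
  have s: "-1 < (x :: real^'n) \<bullet> x" for x by (rule inner_gt_minus_one)
  have ft: "deriv (\<lambda>t. F (x \<bullet> x) t) t = Ft (x \<bullet> x) t" for x :: "real^'n" and t
    by (rule DERIV_imp_deriv[OF Ft[OF s]])
  have d1: "partial i (\<lambda>z. F (z \<bullet> z) t) x = 2 * x $ i * F1 (x \<bullet> x) t"
    and h1: "has_partial i (\<lambda>z. F (z \<bullet> z) t) x" for x :: "real^'n" and t i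
    using partial_radial[OF F1[OF s]] has_partial_radial[OF F1[OF s]] by auto
  have d2: "partial i (partial j (\<lambda>z. F (z \<bullet> z) t)) x
      = 4 * x $ i * x $ j * F2 (x \<bullet> x) t + (if i = j then 2 * F1 (x \<bullet> x) t else 0)"
    for x :: "real^'n" and t i j
    by (rule partial2_radial[OF F1 F2])
  have h2: "has_partial i (partial j (\<lambda>z. F (z \<bullet> z) t)) x" for x :: "real^'n" and t i j
    by (rule has_partial2_radial[OF F1 F2])
  have ht: "(\<lambda>t. F (x \<bullet> x) t) field_differentiable (at t)" for x :: "real^'n" and t
    using Ft[OF s] by (auto simp: field_differentiable_def)
  note k = c'[OF cont(1)] c'[OF cont(2)] c'[OF cont(3)] c'[OF cont(4)]
  have pc: "continuous_on \<Omega> (\<lambda>(x, t). partial i (\<lambda>z. F (z \<bullet> z) t) x)"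
    "continuous_on \<Omega> (\<lambda>(x, t). partial i (partial j (\<lambda>z. F (z \<bullet> z) t)) x)" for i j
    unfolding d1 d2 case_prod_beta by (intro continuous_intros k if_cont)+
  show ?thesis
    unfolding C21_on_def case_prod_conv ft using h1 h2 ht pc k(1,4)
    by (auto simp: case_prod_beta)
qed

section \<open>Strict inequalities for the two profiles\<close>

lemma weight_nonneg: "0 \<le> weight m g"
  by (simp add: weight_def)

lemma weight_mult:
  "0 < c \<Longrightarrow> 0 \<le> g \<Longrightarrow> weight m (c * g) = c powr m * weight m g"
  by (simp add: weight_def powr_mult)

lemma weight_times_square:
  assumes "0 \<le> g" "0 \<le> m" shows "weight m g * g\<^sup>2 = g powr (m + 2)"
proof (cases "g = 0")
  case False
  then have "weight m g * g\<^sup>2 = g powr m * g powr 2"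
    using assms by (simp add: weight_def)
  then show ?thesis by (simp add: powr_add)
qed simp

lemma weight_mono: "0 \<le> g \<Longrightarrow> g \<le> g' \<Longrightarrow> 0 \<le> m \<Longrightarrow> weight m g \<le> weight m g'"
  by (simp add: weight_def powr_mono2)

text \<open>For a test function \<open>e\<^bsup>h\<^esup>\<close> of value \<open>a\<close> the expression is homogeneous in \<open>a\<close>, which leaves
  \<open>A|Dh|\<^bsup>P\<^esup> + |Dh|\<^bsup>P-2\<^esup>(4 A s h'' + 2 B h') - (P - 1) h\<^sub>t\<close>. The second derivative has a favourable
  sign for a concave profile and is dropped.\<close>

lemma radial_Gamma_exp_less:
  assumes p: "2 \<le> p" and a: "0 < a" and s: "0 \<le> s" and h: "0 \<le> h1" "h2 \<le> 0"
    and less: "coeff_second p * (2 * h1 * sqrt s) powr eff_exponent p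
      + 2 * coeff_first n p * (weight (eff_exponent p - 2) (2 * h1 * sqrt s) * h1) < (eff_exponent p - 1) * ht"
  shows "radial_Gamma n p s a (a * h1) (a * (h2 + h1\<^sup>2)) (a * ht) < 0"
proof -
  define m where "m = eff_exponent p - 2"
  have m: "0 \<le> m" using eff_exponent_ge_2[OF p] m_def by simp
  define g where "g = 2 * h1 * sqrt s"
  have g: "0 \<le> g" using h s by (simp add: g_def)
  have g2: "g\<^sup>2 = 4 * h1\<^sup>2 * s" using s by (simp add: g_def power_mult_distrib)
  have A: "0 < coeff_second p" by (rule coeff_second_pos[OF p])
  have "2 * \<bar>a * h1\<bar> * sqrt s = a * g" using a h by (simp add: g_def abs_mult)
  then have "radial_Gamma n p s a (a * h1) (a * (h2 + h1\<^sup>2)) (a * ht)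
     = a powr m * a * (weight m g * (4 * coeff_second p * s * (h2 + h1\<^sup>2) + 2 * coeff_first n p * h1) - (eff_exponent p - 1) * ht)"
    using weight_mult[OF a g, of m] by (simp add: radial_Gamma_def m_def algebra_simps)
  moreover have "weight m g * (4 * coeff_second p * s * (h2 + h1\<^sup>2) + 2 * coeff_first n p * h1)
      \<le> weight m g * (coeff_second p * g\<^sup>2 + 2 * coeff_first n p * h1)"
  proof (intro mult_left_mono add_right_mono weight_nonneg)
    have "coeff_second p * s * h2 \<le> 0" using A s h by (simp add: mult_nonneg_nonpos)
    then show "4 * coeff_second p * s * (h2 + h1\<^sup>2) \<le> coeff_second p * g\<^sup>2"
      unfolding g2 by (simp add: algebra_simps)
  qed
  moreover have "weight m g * (coeff_second p * g\<^sup>2 + 2 * coeff_first n p * h1)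
      = coeff_second p * g powr eff_exponent p + 2 * coeff_first n p * (weight m g * h1)"
    using weight_times_square[OF g m] by (simp add: m_def algebra_simps)
  ultimately show ?thesis
    using less a by (simp add: g_def m_def mult_less_0_iff zero_less_mult_iff)
qed

text \<open>This is where the growth exponent \<open>q = P/(P - 1)\<close> comes from. If \<open>h\<close> grows like \<open>\<delta> |x|\<^bsup>q\<^esup>\<close>, then
  \<open>|Dh|\<^bsup>P\<^esup>\<close> grows like \<open>|x|\<^bsup>(q-1)P\<^esup> = |x|\<^bsup>q\<^esup>\<close>, just like \<open>h\<close> itself, while the remaining diffusion
  term has growth exponent \<open>(q - 1)(P - 1) - 1 = 0\<close> and stays bounded. Here \<open>\<gamma> = q/2\<close> since
  the profile is a function of \<open>s = |x|\<^sup>2\<close>.\<close>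

lemma power_profile_gradient_bounds:
  fixes P \<delta> s :: real
  assumes P: "2 \<le> P" and \<delta>: "0 < \<delta>" and s: "0 \<le> s"
  defines "\<gamma> \<equiv> P / (P - 1) / 2"
  defines "h1 \<equiv> \<delta> * (1 + s) powr (\<gamma> - 1)"
  shows "(2 * h1 * sqrt s) powr P \<le> (2 * \<delta>) powr P * (1 + s) powr \<gamma>"
    and "2 * (weight (P - 2) (2 * h1 * sqrt s) * h1) \<le> (2 * \<delta>) powr (P - 1)"
proof -
  let ?w = "1 + s"
  have w: "1 \<le> ?w" using s by simp
  have h1: "0 \<le> h1" using \<delta> by (simp add: h1_def)
  have "sqrt s \<le> sqrt ?w" by simp
  also have "\<dots> = ?w powr (1/2)" using w by (simp add: powr_half_sqrt)
  finally have "2 * h1 * sqrt s \<le> 2 * h1 * ?w powr (1/2)" using h1 by (intro mult_left_mono) auto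
  also have "\<dots> = (2 * \<delta>) * ?w powr (\<gamma> - 1/2)"
    by (simp add: h1_def flip: powr_add)
  finally have g: "2 * h1 * sqrt s \<le> (2 * \<delta>) * ?w powr (\<gamma> - 1/2)" .
  have g0: "0 \<le> 2 * h1 * sqrt s" using h1 s by simp
  have e1: "P * (\<gamma> - 1/2) = \<gamma>" using P by (simp add: \<gamma>_def field_simps)
  have e2: "(P - 2) * (\<gamma> - 1/2) + (\<gamma> - 1) = 0" using P by (simp add: \<gamma>_def field_simps)
  have "(2 * h1 * sqrt s) powr P \<le> ((2 * \<delta>) * ?w powr (\<gamma> - 1/2)) powr P"
    using g g0 P by (intro powr_mono2) auto
  also have "\<dots> = (2 * \<delta>) powr P * ?w powr (P * (\<gamma> - 1/2))"
    using \<delta> w by (simp add: powr_mult powr_powr mult.commute)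
  finally show "(2 * h1 * sqrt s) powr P \<le> (2 * \<delta>) powr P * ?w powr \<gamma>" unfolding e1 .
  have "weight (P - 2) (2 * h1 * sqrt s) \<le> weight (P - 2) ((2 * \<delta>) * ?w powr (\<gamma> - 1/2))"
    using g g0 P by (intro weight_mono) auto
  also have "\<dots> = (2 * \<delta>) powr (P - 2) * ?w powr ((P - 2) * (\<gamma> - 1/2))"
    using \<delta> w by (auto simp: weight_def powr_mult powr_powr mult.commute)
  finally have "weight (P - 2) (2 * h1 * sqrt s) * (2 * h1)
     \<le> ((2 * \<delta>) powr (P - 2) * ?w powr ((P - 2) * (\<gamma> - 1/2))) * (2 * h1)"
    using h1 by (intro mult_right_mono) auto
  also have "\<dots> = (2 * \<delta>) powr (P - 2) * (2 * \<delta>) powr 1 * ?w powr ((P - 2) * (\<gamma> - 1/2) + (\<gamma> - 1))"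
    unfolding powr_add using \<delta> by (simp add: h1_def)
  also have "\<dots> = (2 * \<delta>) powr (P - 1)"
  proof -
    have "(2 * \<delta>) powr (P - 2) * (2 * \<delta>) powr 1 = (2 * \<delta>) powr (P - 2 + 1)"
      by (rule powr_add[symmetric])
    also have "P - 2 + 1 = P - 1" by simp
    finally show ?thesis unfolding e2 using w by (simp del: powr_one)
  qed
  finally show "2 * (weight (P - 2) (2 * h1 * sqrt s) * h1) \<le> (2 * \<delta>) powr (P - 1)"
    by (simp add: mult.assoc mult.left_commute)
qed

text \<open>A small slope turns the powers of \<open>\<delta>\<close> into a quadratic and a linear term, uniformly in \<open>P \<ge> 2\<close>.\<close>

lemma growing_profile_inequality:
  fixes P \<delta> s :: real
  assumes P: "2 \<le> P" and \<delta>: "0 < \<delta>" "2 * \<delta> \<le> 1" and s: "0 \<le> s" and AB: "0 \<le> A" "0 \<le> B"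
  defines "\<gamma> \<equiv> P / (P - 1) / 2"
  defines "h1 \<equiv> \<delta> * (1 + s) powr (\<gamma> - 1)"
  shows "A * (2 * h1 * sqrt s) powr P + 2 * B * (weight (P - 2) (2 * h1 * sqrt s) * h1)
      \<le> A * (2 * \<delta>)\<^sup>2 * (1 + s) powr \<gamma> + B * (2 * \<delta>)"
proof -
  note b = power_profile_gradient_bounds[OF P \<delta>(1) s, folded \<gamma>_def, folded h1_def]
  have "(2 * \<delta>) powr P \<le> (2 * \<delta>) powr 2" using P \<delta> by (intro powr_mono') auto
  then have "(2 * \<delta>) powr P * (1 + s) powr \<gamma> \<le> (2 * \<delta>)\<^sup>2 * (1 + s) powr \<gamma>"
    using \<delta> by (intro mult_right_mono) auto
  with b(1) have 1: "(2 * h1 * sqrt s) powr P \<le> (2 * \<delta>)\<^sup>2 * (1 + s) powr \<gamma>" by simp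
  have "(2 * \<delta>) powr (P - 1) \<le> (2 * \<delta>) powr 1" using P \<delta> by (intro powr_mono') auto
  with b(2) have 2: "2 * (weight (P - 2) (2 * h1 * sqrt s) * h1) \<le> 2 * \<delta>" using \<delta> by simp
  show ?thesis using mult_left_mono[OF 1 AB(1)] mult_left_mono[OF 2 AB(2)] by (simp add: algebra_simps)
qed

text \<open>With \<open>z = 1 - s/R\<^sup>2\<close> and the bump \<open>E z\<^sup>2\<close>, the spatial operator is a nonnegative multiple of
  \<open>2 A (1 - z) - B z\<close>. Near the edge of the ball, for \<open>z \<le> z0\<close>, it is nonnegative because
  the bump has a double zero there; on the remaining core it is at least of order \<open>-R\<^bsup>-2\<^esup>\<close>, and
  \<open>z > z0\<close> lets the exponential decay in time at rate \<open>\<Lambda>\<close> of order \<open>R\<^bsup>-2\<^esup>\<close> pay for it. For \<open>P > 2\<close> the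
  true order is \<open>R\<^bsup>-P\<^esup>\<close>; the weaker rate suffices, as it also tends to 0.
  The bound \<open>R \<ge> 4\<close> makes the slope of the bump at most \<open>E\<close>, so that the weight is at most 1 when \<open>E = 1\<close>.\<close>

lemma radial_Gamma_bump_pos:
  fixes p :: ereal and n :: "'n::finite itself" and R s E \<Lambda> :: real
  assumes p: "2 \<le> p" and R: "4 \<le> R" and s: "0 \<le> s" "s < R\<^sup>2" and E: "0 < E"
  defines "z0 \<equiv> 2 * coeff_second p / (2 * coeff_second p + coeff_first n p)"
  assumes \<Lambda>: "8 * coeff_first n p / z0 powr (2 * eff_exponent p - 2) / R\<^sup>2 \<le> \<Lambda>"
  shows "0 < radial_Gamma n p s (E * (1 - s / R\<^sup>2)\<^sup>2) (- (2 * E / R\<^sup>2 * (1 - s / R\<^sup>2)))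
      (2 * E / R^4) (- (\<Lambda> * (E * (1 - s / R\<^sup>2)\<^sup>2)))"
proof -
  define z where "z = 1 - s / R\<^sup>2"
  define m where "m = eff_exponent p - 2"
  define A where "A = coeff_second p"
  define B where "B = coeff_first n p"
  define c where "c = eff_exponent p - 1"
  have A: "0 < A" using coeff_second_pos[OF p] A_def by simp
  have B: "0 < B" using coeff_first_pos[OF p] B_def by simp
  have m: "0 \<le> m" and c: "1 \<le> c" using eff_exponent_ge_2[OF p] by (auto simp: m_def c_def)
  have R2: "0 < R\<^sup>2" using R by simp
  have z: "0 < z" "z \<le> 1" using s R2 by (auto simp: z_def)
  have sR: "s / R\<^sup>2 = 1 - z" by (simp add: z_def)
  have z0: "0 < z0" "z0 = 2 * A / (2 * A + B)" using A B by (auto simp: z0_def A_def B_def)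
  define g where "g = 4 * z * sqrt s / R\<^sup>2"
  have g0: "0 \<le> g" using z s by (simp add: g_def)
  have g1: "g \<le> 1"
  proof -
    have "sqrt s \<le> R" using s R by (simp add: real_le_lsqrt)
    then have "z * sqrt s \<le> 1 * R" using z s R by (intro mult_mono) auto
    then have "4 * (z * sqrt s) \<le> 4 * R" by simp
    also have "\<dots> \<le> R * R" using R by (intro mult_right_mono) auto
    finally have "4 * z * sqrt s \<le> R * R" by simp
    then show ?thesis using R2 by (simp add: g_def power2_eq_square)
  qed
  have geq: "2 * \<bar>- (2 * E / R\<^sup>2 * z)\<bar> * sqrt s = E * g"
    using E z R2 by (simp add: g_def abs_mult)
  have R4: "R^4 = R\<^sup>2 * R\<^sup>2" by (simp flip: power_add)
  have lin: "4 * A * s * (2 * E / R^4) + 2 * B * (- (2 * E / R\<^sup>2 * z))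
      = E * (4 / R\<^sup>2) * (2 * A * (1 - z) - B * z)"
    unfolding sR[symmetric] R4 using R2 by (simp add: field_simps)
  have "radial_Gamma n p s (E * z\<^sup>2) (- (2 * E / R\<^sup>2 * z)) (2 * E / R^4) (- (\<Lambda> * (E * z\<^sup>2)))
     = weight m (E * g) * (E * (4 / R\<^sup>2) * (2 * A * (1 - z) - B * z))
        + c * (E * z\<^sup>2) powr m * (\<Lambda> * (E * z\<^sup>2))"
    unfolding radial_Gamma_def geq A_def[symmetric] B_def[symmetric] lin
    by (simp add: m_def c_def)
  also have "\<dots> = E powr m * E * (weight m g * (4 / R\<^sup>2) * (2 * A * (1 - z) - B * z)
        + c * \<Lambda> * z powr (2 * m + 2))"
  proof -
    have "(z\<^sup>2) powr m * z\<^sup>2 = z powr (2 * m + 2)"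
      using z by (simp add: powr_add powr_powr flip: powr_numeral)
    moreover have "(E * z\<^sup>2) powr m = E powr m * (z\<^sup>2) powr m" using E by (simp add: powr_mult)
    ultimately have "(E * z\<^sup>2) powr m * z\<^sup>2 = E powr m * z powr (2 * m + 2)" by simp
    then have "c * (E * z\<^sup>2) powr m * (\<Lambda> * (E * z\<^sup>2)) = c * \<Lambda> * E * (E powr m * z powr (2 * m + 2))"
      by (metis (no_types, opaque_lifting) mult.assoc mult.commute)
    then show ?thesis using weight_mult[OF E g0, of m] by (simp add: algebra_simps)
  qed
  finally have eq: "radial_Gamma n p s (E * z\<^sup>2) (- (2 * E / R\<^sup>2 * z)) (2 * E / R^4) (- (\<Lambda> * (E * z\<^sup>2)))
     = E powr m * E * (weight m g * (4 / R\<^sup>2) * (2 * A * (1 - z) - B * z)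
        + c * \<Lambda> * z powr (2 * m + 2))" .
  have \<Lambda>': "8 * B / z0 powr (2 * m + 2) / R\<^sup>2 \<le> \<Lambda>" using \<Lambda> by (simp add: B_def m_def)
  have "0 < 8 * B / z0 powr (2 * m + 2) / R\<^sup>2" using B z0(1) R2 by simp
  then have \<Lambda>0: "0 < \<Lambda>" using \<Lambda>' by linarith
  have "0 < weight m g * (4 / R\<^sup>2) * (2 * A * (1 - z) - B * z) + c * \<Lambda> * z powr (2 * m + 2)"
  proof (cases "z \<le> z0")
    case True
    then have "z * (2 * A + B) \<le> 2 * A" using A B by (simp add: z0(2) field_simps)
    then have "0 \<le> 2 * A * (1 - z) - B * z" by (simp add: algebra_simps)
    then have "0 \<le> weight m g * (4 / R\<^sup>2) * (2 * A * (1 - z) - B * z)"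
      by (simp add: weight_nonneg)
    moreover have "0 < c * \<Lambda> * z powr (2 * m + 2)" using c \<Lambda>0 z by simp
    ultimately show ?thesis by linarith
  next
    case False
    have "weight m g \<le> weight m 1" using g0 g1 m by (intro weight_mono) auto
    then have w: "weight m g \<le> 1" by (simp add: weight_def split: if_splits)
    have "B * z \<le> B * 1" "0 \<le> 2 * A * (1 - z)" using B A z by (auto intro: mult_left_mono)
    then have "- B \<le> 2 * A * (1 - z) - B * z" by linarith
    then have "weight m g * (4 / R\<^sup>2) * (- B) \<le> weight m g * (4 / R\<^sup>2) * (2 * A * (1 - z) - B * z)"
      using R2 by (intro mult_left_mono) (auto simp: weight_nonneg)
    moreover have "1 * (4 / R\<^sup>2) * (- B) \<le> weight m g * (4 / R\<^sup>2) * (- B)"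
      using w B by (intro mult_right_mono_neg mult_right_mono) auto
    moreover have "8 * B / R\<^sup>2 \<le> c * \<Lambda> * z powr (2 * m + 2)"
    proof -
      have "8 * B / R\<^sup>2 = 1 * (8 * B / z0 powr (2 * m + 2) / R\<^sup>2) * z0 powr (2 * m + 2)"
        using z0(1) by simp
      also have "\<dots> \<le> c * \<Lambda> * z powr (2 * m + 2)"
        using c \<Lambda>' \<Lambda>0 B z0 False m R2 by (intro mult_mono powr_mono2) auto
      finally show ?thesis .
    qed
    moreover have "4 * B / R\<^sup>2 < 8 * B / R\<^sup>2" using B R2 by (simp add: divide_strict_right_mono)
    ultimately show ?thesis by simp
  qed
  then show ?thesis using E eq by (simp add: z_def)
qed

text \<open>The derivatives are carried along, since they enter the strictness conditions on barriers.\<close>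

definition radial_C21 ::
  "(real \<Rightarrow> real \<Rightarrow> real) \<Rightarrow> (real \<Rightarrow> real \<Rightarrow> real) \<Rightarrow> (real \<Rightarrow> real \<Rightarrow> real) \<Rightarrow> (real \<Rightarrow> real \<Rightarrow> real) \<Rightarrow> bool"
  where
  "radial_C21 F F1 F2 Ft \<longleftrightarrow>
     (\<forall>s t. -1 < s \<longrightarrow> ((\<lambda>s. F s t) has_field_derivative F1 s t) (at s) \<and>
                  ((\<lambda>s. F1 s t) has_field_derivative F2 s t) (at s) \<and>
                  ((\<lambda>t. F s t) has_field_derivative Ft s t) (at t)) \<and>
     (\<forall>H\<in>{F, F1, F2, Ft}. continuous_on ({0..} \<times> UNIV) (\<lambda>(s, t). H s t))"

lemma radial_C21_scale:
  assumes "radial_C21 F F1 F2 Ft"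
  shows "radial_C21 (\<lambda>s t. c * F s t) (\<lambda>s t. c * F1 s t) (\<lambda>s t. c * F2 s t) (\<lambda>s t. c * Ft s t)"
  using assms unfolding radial_C21_def
  by (auto simp: case_prod_beta intro!: continuous_intros DERIV_cmult)

lemma radial_C21_imp_C21_on:
  "radial_C21 F F1 F2 Ft \<Longrightarrow> C21_on \<Omega> (\<lambda>(x :: real^'n::finite, t). F (x \<bullet> x) t)"
  unfolding radial_C21_def by (rule C21_on_radial[of F F1 F2 Ft]) auto

lemma radial_C21_Gamma_test:
  "radial_C21 F F1 F2 Ft \<Longrightarrow> 2 \<le> p \<Longrightarrow> 0 < a \<Longrightarrow>
   Gamma_test p a (\<lambda>(x, t). F (x \<bullet> x) t) (y :: real^'n::finite) t
      = radial_Gamma TYPE('n) p (y \<bullet> y) a (F1 (y \<bullet> y) t) (F2 (y \<bullet> y) t) (Ft (y \<bullet> y) t)"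
  unfolding radial_C21_def using inner_gt_minus_one[of y] by (intro Gamma_test_radial) auto

lemma radial_C21_continuous_on:
  assumes "radial_C21 F F1 F2 Ft"
  shows "continuous_on S (\<lambda>(x :: real^'n::finite, t). F (x \<bullet> x) t)"
  using radial_C21_imp_C21_on[OF assms, of S] by (simp add: C21_on_def)

section \<open>Comparison with a strict radial barrier\<close>

text \<open>The ratio must be controlled on the lid \<open>t = \<tau>\<close> as well as on the parabolic boundary: the
  definition of viscosity solutions only tests local extrema in full neighbourhoods, so a maximum on the lid
  would give no information.\<close>

lemma interior_maximum_on_cylinder:
  fixes \<rho> :: "'a::euclidean_space \<times> real \<Rightarrow> real"
  assumes cont: "continuous_on (cball 0 R \<times> {0..\<tau>}) \<rho>"
    and lateral: "\<And>x t. norm x = R \<Longrightarrow> 0 \<le> t \<Longrightarrow> t \<le> \<tau> \<Longrightarrow> \<rho> (x, t) \<le> 1"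
    and bottom: "\<And>x. norm x \<le> R \<Longrightarrow> \<rho> (x, 0) \<le> 1"
    and top: "\<And>x. norm x \<le> R \<Longrightarrow> \<rho> (x, \<tau>) \<le> 1"
    and x0: "norm x0 \<le> R" "0 \<le> t0" "t0 \<le> \<tau>" "1 < \<rho> (x0, t0)"
  obtains y s where "norm y < R" "0 < s" "s < \<tau>" "1 < \<rho> (y, s)"
    "\<forall>\<^sub>F w in nhds (y, s). \<rho> w \<le> \<rho> (y, s)"
proof -
  have "\<exists>z\<in>cball 0 R \<times> {0..\<tau>}. \<forall>w\<in>cball 0 R \<times> {0..\<tau>}. \<rho> w \<le> \<rho> z"
    using x0 order_trans[OF norm_ge_zero x0(1)]
    by (intro continuous_attains_sup cont compact_Times) auto
  then obtain y s where ys: "norm y \<le> R" "0 \<le> s" "s \<le> \<tau>"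
    and max: "\<And>w. w \<in> cball 0 R \<times> {0..\<tau>} \<Longrightarrow> \<rho> w \<le> \<rho> (y, s)" by auto
  have "\<rho> (x0, t0) \<le> \<rho> (y, s)" using x0 by (intro max) auto
  then have 1: "1 < \<rho> (y, s)" using x0 by linarith
  then have int: "norm y < R" "0 < s" "s < \<tau>"
    using lateral[of y s] bottom[of y] top[of y] ys by (force simp: less_le)+
  have "open (ball (0 :: 'a) R \<times> {0<..<\<tau>})" by (intro open_Times) auto
  then have "\<forall>\<^sub>F w in nhds (y, s). w \<in> ball 0 R \<times> {0<..<\<tau>}"
    using int by (intro eventually_nhds_in_open) auto
  then have "\<forall>\<^sub>F w in nhds (y, s). \<rho> w \<le> \<rho> (y, s)"
    by (rule eventually_mono) (auto intro!: max)
  with int 1 show ?thesis by (rule that)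
qed

lemma eventually_in_cylinder:
  assumes "0 < s" "s < T"
  shows "\<forall>\<^sub>F w in nhds (y :: real^'n::finite, s). w \<in> cylinder T"
  using assms by (intro eventually_nhds_in_open open_Times) auto

text \<open>Differences \<open>u - \<psi>\<close> are not suited to comparison here, since adding constants to \<open>u\<close> does not
  preserve the equation; but it is invariant under \<open>u \<mapsto> \<mu> u\<close>. So the ratio \<open>u/\<psi>\<close> is maximized, and its
  maximum \<open>\<mu>\<close> turns \<open>\<mu> \<psi>\<close> into a test function that touches \<open>u\<close> from above and agrees with \<open>u\<close> at the
  contact point, which makes the value \<open>u(y, s)\<close> in the tested expression equal to that of the barrier.\<close>

lemma subsolution_below_radial_barrier:
  fixes u :: "(real^'n::finite) \<times> real \<Rightarrow> real"
  assumes p: "2 \<le> p" and sub: "viscosity_subsolution p T u" and \<tau>: "\<tau> < T"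
    and cont: "continuous_on (cball 0 R \<times> {0..\<tau>}) u"
    and F: "radial_C21 F F1 F2 Ft" and pos: "\<And>s t. 0 < F s t"
    and strict: "\<And>\<mu> s t. 0 < \<mu> \<Longrightarrow> 0 \<le> s \<Longrightarrow> s < R\<^sup>2 \<Longrightarrow> 0 < t \<Longrightarrow> t < \<tau> \<Longrightarrow>
      radial_Gamma TYPE('n) p s (\<mu> * F s t) (\<mu> * F1 s t) (\<mu> * F2 s t) (\<mu> * Ft s t) < 0"
    and lateral: "\<And>x t. norm x = R \<Longrightarrow> 0 \<le> t \<Longrightarrow> t \<le> \<tau> \<Longrightarrow> u (x, t) \<le> F (x \<bullet> x) t"
    and bottom: "\<And>x. norm x \<le> R \<Longrightarrow> u (x, 0) \<le> F (x \<bullet> x) 0"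
    and top: "\<And>x. norm x \<le> R \<Longrightarrow> u (x, \<tau>) \<le> F (x \<bullet> x) \<tau>"
    and x0: "norm x0 \<le> R" "0 \<le> t0" "t0 \<le> \<tau>"
  shows "u (x0, t0) \<le> F (x0 \<bullet> x0) t0"
proof (rule ccontr)
  assume neg: "\<not> ?thesis"
  define \<psi> where "\<psi> = (\<lambda>(x :: real^'n, t). F (x \<bullet> x) t)"
  have \<psi>: "0 < \<psi> z" for z using pos by (auto simp: \<psi>_def case_prod_beta)
  have contr: "continuous_on (cball 0 R \<times> {0..\<tau>}) (\<lambda>z. u z / \<psi> z)"
    using \<psi> radial_C21_continuous_on[OF F]
    by (intro continuous_on_divide cont) (auto simp: \<psi>_def less_le)
  from contr obtain y s where ys: "norm y < R" "0 < s" "s < \<tau>" "1 < u (y, s) / \<psi> (y, s)"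
    and max: "\<forall>\<^sub>F w in nhds (y, s). u w / \<psi> w \<le> u (y, s) / \<psi> (y, s)"
    by (rule interior_maximum_on_cylinder[OF _ _ _ _ x0])
      (use lateral bottom top neg pos in \<open>auto simp: \<psi>_def\<close>)
  define \<mu> where "\<mu> = u (y, s) / \<psi> (y, s)"
  have \<mu>: "0 < \<mu>" using ys by (simp add: \<mu>_def)
  have eq: "u (y, s) = \<mu> * F (y \<bullet> y) s" using pos[of "y \<bullet> y" s] by (simp add: \<mu>_def \<psi>_def)
  have a: "0 < u (y, s)" unfolding eq using \<mu> pos by simp
  let ?\<phi> = "\<lambda>(x :: real^'n, t). \<mu> * F (x \<bullet> x) t"
  note Fs = radial_C21_scale[OF F, of \<mu>]
  have "local_max_at (\<lambda>z. u z - ?\<phi> z) (y, s)"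
    unfolding local_max_at_def using max
  proof (rule eventually_mono)
    fix w assume "u w / \<psi> w \<le> u (y, s) / \<psi> (y, s)"
    then have "u w \<le> \<mu> * \<psi> w" using \<psi>[of w] by (simp add: \<mu>_def field_simps)
    then show "u w - ?\<phi> w \<le> u (y, s) - ?\<phi> (y, s)" by (simp add: eq \<psi>_def case_prod_beta)
  qed
  moreover have "(y, s) \<in> cylinder T" using ys \<tau> by auto
  ultimately have "0 \<le> Gamma_test p (u (y, s)) ?\<phi> y s"
    using sub radial_C21_imp_C21_on[OF Fs] unfolding viscosity_subsolution_def by blast
  moreover have "y \<bullet> y < R\<^sup>2" using ys by (simp add: dot_square_norm power_strict_mono)
  ultimately show False
    using strict[OF \<mu>, of "y \<bullet> y" s] ys radial_C21_Gamma_test[OF Fs p a, of y s] by (simp add: eq)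
qed

text \<open>The roles of \<open>u\<close> and \<open>\<psi>\<close> in the ratio are exchanged, since the barrier may vanish on the lateral
  boundary while \<open>u\<close> does not.\<close>

lemma supersolution_above_radial_barrier:
  fixes u :: "(real^'n::finite) \<times> real \<Rightarrow> real"
  assumes p: "2 \<le> p" and super: "viscosity_supersolution p T u" and \<tau>: "\<tau> < T"
    and cont: "continuous_on (cball 0 R \<times> {0..\<tau>}) u"
    and upos: "\<And>z. z \<in> cball 0 R \<times> {0..\<tau>} \<Longrightarrow> 0 < u z"
    and F: "radial_C21 F F1 F2 Ft"
    and strict: "\<And>\<mu> s t. 0 < \<mu> \<Longrightarrow> 0 \<le> s \<Longrightarrow> s < R\<^sup>2 \<Longrightarrow> 0 < t \<Longrightarrow> t < \<tau> \<Longrightarrow>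
      0 < radial_Gamma TYPE('n) p s (\<mu> * F s t) (\<mu> * F1 s t) (\<mu> * F2 s t) (\<mu> * Ft s t)"
    and lateral: "\<And>x t. norm x = R \<Longrightarrow> 0 \<le> t \<Longrightarrow> t \<le> \<tau> \<Longrightarrow> F (x \<bullet> x) t \<le> u (x, t)"
    and bottom: "\<And>x. norm x \<le> R \<Longrightarrow> F (x \<bullet> x) 0 \<le> u (x, 0)"
    and top: "\<And>x. norm x \<le> R \<Longrightarrow> F (x \<bullet> x) \<tau> \<le> u (x, \<tau>)"
    and x0: "norm x0 \<le> R" "0 \<le> t0" "t0 \<le> \<tau>"
  shows "F (x0 \<bullet> x0) t0 \<le> u (x0, t0)"
proof (rule ccontr)
  assume neg: "\<not> ?thesis"
  define \<psi> where "\<psi> = (\<lambda>(x :: real^'n, t). F (x \<bullet> x) t)"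
  have ucyl: "0 < u z" if "z \<in> cylinder T" for z
    using super that by (auto simp: viscosity_supersolution_def)
  have contr: "continuous_on (cball 0 R \<times> {0..\<tau>}) (\<lambda>z. \<psi> z / u z)"
    using upos radial_C21_continuous_on[OF F]
    by (intro continuous_on_divide cont) (force simp: \<psi>_def)+
  have le: "\<psi> (x, t) / u (x, t) \<le> 1"
    if "norm x \<le> R" "0 \<le> t" "t \<le> \<tau>" "F (x \<bullet> x) t \<le> u (x, t)" for x t
    using upos[of "(x, t)"] that by (simp add: \<psi>_def)
  have 0: "0 \<le> \<tau>" using x0 by simp
  have gt: "1 < \<psi> (x0, t0) / u (x0, t0)"
    using upos[of "(x0, t0)"] neg x0 by (simp add: \<psi>_def)
  from contr obtain y s where ys: "norm y < R" "0 < s" "s < \<tau>" "1 < \<psi> (y, s) / u (y, s)"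
    and max: "\<forall>\<^sub>F w in nhds (y, s). \<psi> w / u w \<le> \<psi> (y, s) / u (y, s)"
    by (rule interior_maximum_on_cylinder[where \<rho> = "\<lambda>z. \<psi> z / u z", OF _ _ _ _ x0 gt])
      (use lateral bottom top 0 in \<open>auto intro!: le\<close>)
  have cyl: "(y, s) \<in> cylinder T" using ys \<tau> by auto
  have a: "0 < u (y, s)" by (rule ucyl[OF cyl])
  then have \<psi>ys: "0 < \<psi> (y, s)" using ys by (simp add: field_simps)
  define \<mu> where "\<mu> = u (y, s) / \<psi> (y, s)"
  have \<mu>: "0 < \<mu>" using a \<psi>ys by (simp add: \<mu>_def)
  have eq: "u (y, s) = \<mu> * F (y \<bullet> y) s" using \<psi>ys by (simp add: \<mu>_def \<psi>_def)
  let ?\<phi> = "\<lambda>(x :: real^'n, t). \<mu> * F (x \<bullet> x) t"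
  note Fs = radial_C21_scale[OF F, of \<mu>]
  have "local_min_at (\<lambda>z. u z - ?\<phi> z) (y, s)"
    unfolding local_min_at_def using max eventually_in_cylinder[OF ys(2) less_trans[OF ys(3) \<tau>]]
  proof eventually_elim
    fix w assume w: "\<psi> w / u w \<le> \<psi> (y, s) / u (y, s)" "w \<in> cylinder T"
    then have "\<mu> * \<psi> w \<le> u w" using ucyl[of w] a \<psi>ys by (simp add: \<mu>_def field_simps)
    then show "u (y, s) - ?\<phi> (y, s) \<le> u w - ?\<phi> w" by (simp add: eq \<psi>_def case_prod_beta)
  qed
  with cyl have "Gamma_test p (u (y, s)) ?\<phi> y s \<le> 0"
    using super radial_C21_imp_C21_on[OF Fs] unfolding viscosity_supersolution_def by blast
  moreover have "y \<bullet> y < R\<^sup>2" using ys by (simp add: dot_square_norm power_strict_mono)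
  ultimately show False
    using strict[OF \<mu>, of "y \<bullet> y" s] ys radial_C21_Gamma_test[OF Fs p a, of y s] by (simp add: eq)
qed

section \<open>The time penalty\<close>

text \<open>The lid is kept harmless by the exponent \<open>N (max 0 (t - t0))\<^sup>2\<close>: it is \<open>C\<^sup>1\<close>, vanishes up to the
  time \<open>t0\<close> of interest, has a derivative of the good sign, and is as large as desired at \<open>\<tau> > t0\<close>.
  A penalty such as \<open>1/(\<tau> - t)\<close> would be singular inside the cylinder, where test functions must
  be smooth.\<close>

lemma DERIV_positive_part_square:
  "((\<lambda>x :: real. (max 0 x)\<^sup>2) has_field_derivative 2 * max 0 x) (at x)"
proof -
  consider "x < 0" | "x = 0" | "0 < x" by linarith
  then show ?thesis
  proof cases
    case 1
    have "((\<lambda>x :: real. 0) has_field_derivative 2 * max 0 x) (at x)" using 1 by simp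
    then show ?thesis
      by (rule has_field_derivative_transform_within_open[where S = "{..<0}"]) (use 1 in auto)
  next
    case 2
    have "((\<lambda>h :: real. max 0 h) \<longlongrightarrow> max 0 0) (at 0)" by (intro tendsto_intros)
    moreover have "\<forall>\<^sub>F h :: real in at 0. max 0 h = (max 0 h)\<^sup>2 / h"
      by (auto simp: eventually_at_filter max_def power2_eq_square)
    ultimately have "((\<lambda>h :: real. (max 0 h)\<^sup>2 / h) \<longlongrightarrow> max 0 0) (at 0)"
      by (rule Lim_transform_eventually)
    then show ?thesis using 2 by (simp add: DERIV_def)
  next
    case 3
    have "((\<lambda>x :: real. x\<^sup>2) has_field_derivative 2 * max 0 x) (at x)"
      using 3 by (auto intro!: derivative_eq_intros)
    then show ?thesis
      by (rule has_field_derivative_transform_within_open[where S = "{0<..}"]) (use 3 in auto)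
  qed
qed

lemma DERIV_time_penalty:
  "((\<lambda>t :: real. N * (max 0 (t - t0))\<^sup>2) has_field_derivative 2 * N * max 0 (t - t0)) (at t)"
proof -
  have "((\<lambda>t. t - t0) has_field_derivative 1) (at t)"
    by (auto intro!: derivative_eq_intros)
  from DERIV_cmult[OF DERIV_chain'[OF this DERIV_positive_part_square], of N] show ?thesis
    by (simp add: mult.left_commute mult.assoc)
qed

lemma penalty_strength:
  fixes d X :: real
  assumes "d \<noteq> 0"
  obtains N where "0 \<le> N" "X \<le> N * d\<^sup>2"
  using that[of "\<bar>X\<bar> / d\<^sup>2"] assms by auto

section \<open>The upper bound\<close>

context
  fixes \<epsilon> \<gamma> K N t0 b :: real
begin

text \<open>The logarithm of the upper barrier. The factor \<open>1 + t\<close> produces a time derivative proportional to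
  \<open>(1 + s)\<^bsup>\<gamma>\<^esup>\<close>, to absorb the gradient term; \<open>K t\<close> absorbs the bounded diffusion term.\<close>

definition growth_height :: "real \<Rightarrow> real \<Rightarrow> real" where
  "growth_height s t = b + \<epsilon> * ((1 + t) * (1 + s) powr \<gamma> + K * t) + N * (max 0 (t - t0))\<^sup>2"

definition growth_height_s :: "real \<Rightarrow> real \<Rightarrow> real" where
  "growth_height_s s t = \<epsilon> * (1 + t) * \<gamma> * (1 + s) powr (\<gamma> - 1)"

definition growth_height_ss :: "real \<Rightarrow> real \<Rightarrow> real" where
  "growth_height_ss s t = \<epsilon> * (1 + t) * \<gamma> * ((\<gamma> - 1) * (1 + s) powr (\<gamma> - 2))"

definition growth_height_t :: "real \<Rightarrow> real \<Rightarrow> real" where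
  "growth_height_t s t = \<epsilon> * ((1 + s) powr \<gamma> + K) + 2 * N * max 0 (t - t0)"

lemma radial_C21_exp_growth_height:
  "radial_C21 (\<lambda>s t. exp (growth_height s t))
     (\<lambda>s t. exp (growth_height s t) * growth_height_s s t)
     (\<lambda>s t. exp (growth_height s t) * (growth_height_ss s t + (growth_height_s s t)\<^sup>2))
     (\<lambda>s t. exp (growth_height s t) * growth_height_t s t)"
proof -
  have 1: "((\<lambda>s. growth_height s t) has_field_derivative growth_height_s s t) (at s)" if "-1 < s" for s t
    unfolding growth_height_def growth_height_s_def using that
    by (auto intro!: derivative_eq_intros)
  have 2: "((\<lambda>s. growth_height_s s t) has_field_derivative growth_height_ss s t) (at s)" if "-1 < s" for s t
    unfolding growth_height_s_def growth_height_ss_def using that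
    by (auto intro!: derivative_eq_intros simp: algebra_simps)
  have 3: "((\<lambda>t. growth_height s t) has_field_derivative growth_height_t s t) (at t)" for s t
    unfolding growth_height_def growth_height_t_def
    by (rule derivative_eq_intros DERIV_time_penalty refl)+ (simp add: algebra_simps)
  have c: "continuous_on ({0..} \<times> UNIV) (\<lambda>(s, t). growth_height s t)"
    "continuous_on ({0..} \<times> UNIV) (\<lambda>(s, t). growth_height_s s t)"
    "continuous_on ({0..} \<times> UNIV) (\<lambda>(s, t). growth_height_ss s t)"
    "continuous_on ({0..} \<times> UNIV) (\<lambda>(s, t). growth_height_t s t)"
    unfolding growth_height_def growth_height_s_def growth_height_ss_def growth_height_t_def case_prod_beta
    by (auto intro!: continuous_intros)
  show ?thesis
    unfolding radial_C21_def
    using c by (auto simp: case_prod_beta power2_eq_square algebra_simps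
        intro!: continuous_intros derivative_eq_intros 1 2 3)
qed

end

text \<open>Because of \<open>P \<ge> 2\<close> the gradient term is quadratically small in \<open>\<epsilon>\<close>, whereas the time derivative
  is linear in \<open>\<epsilon>\<close>; hence a small \<open>\<epsilon>\<close> makes the barrier a strict supersolution on the
  whole time interval \<open>(0, T)\<close>, however large \<open>T\<close> is.\<close>

lemma growth_barrier_strict:
  fixes p :: ereal and T \<epsilon> K N t0 b \<mu> s t :: real
  assumes p: "2 \<le> p" and T: "0 < T" and \<epsilon>: "0 < \<epsilon>" "\<epsilon> * (2 * (1 + T)) \<le> 1"
    "coeff_second p * \<epsilon> * (2 * (1 + T))\<^sup>2 \<le> eff_exponent p - 1"
    and K: "(eff_exponent p - 1) * K = coeff_first TYPE('n::finite) p * (2 * (1 + T)) + 1" and N: "0 \<le> N"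
    and \<mu>: "0 < \<mu>" and s: "0 \<le> s" and t: "0 < t" "t < T"
  defines "\<gamma> \<equiv> eff_exponent p / (eff_exponent p - 1) / 2"
  defines "E \<equiv> exp (growth_height \<epsilon> \<gamma> K N t0 b s t)"
    and "h1 \<equiv> growth_height_s \<epsilon> \<gamma> s t"
    and "h2 \<equiv> growth_height_ss \<epsilon> \<gamma> s t"
    and "ht \<equiv> growth_height_t \<epsilon> \<gamma> K N t0 s t"
  shows "radial_Gamma TYPE('n) p s (\<mu> * E) (\<mu> * (E * h1)) (\<mu> * (E * (h2 + h1\<^sup>2))) (\<mu> * (E * ht)) < 0"
proof -
  define c where "c = eff_exponent p - 1"
  define D where "D = 2 * (1 + T)"
  define A where "A = coeff_second p"
  define B where "B = coeff_first TYPE('n) p"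
  have c: "1 \<le> c" using eff_exponent_ge_2[OF p] by (simp add: c_def)
  have A: "0 < A" using coeff_second_pos[OF p] by (simp add: A_def)
  have B: "0 < B" using coeff_first_pos[OF p] by (simp add: B_def)
  have \<gamma>: "0 < \<gamma>" "\<gamma> \<le> 1" using eff_exponent_ge_2[OF p] by (auto simp: \<gamma>_def field_simps)
  define \<delta> where "\<delta> = \<epsilon> * (1 + t) * \<gamma>"
  have \<delta>0: "0 < \<delta>" using \<epsilon> t \<gamma> by (simp add: \<delta>_def)
  have "\<epsilon> * (1 + t) * \<gamma> \<le> \<epsilon> * (1 + T) * 1" using \<epsilon> t \<gamma> T by (intro mult_mono) auto
  then have \<delta>D: "2 * \<delta> \<le> \<epsilon> * D" by (simp add: \<delta>_def D_def algebra_simps)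
  then have \<delta>1: "2 * \<delta> \<le> 1" using \<epsilon> by (simp add: D_def)
  have h1: "h1 = \<delta> * (1 + s) powr (\<gamma> - 1)" by (simp add: h1_def growth_height_s_def \<delta>_def)
  have h2: "h2 \<le> 0"
    unfolding h2_def growth_height_ss_def
    using \<epsilon> t \<gamma> by (intro mult_nonneg_nonpos mult_nonpos_nonneg) auto
  let ?w = "(1 + s) powr \<gamma>"
  have "A * (2 * h1 * sqrt s) powr eff_exponent p + 2 * B * (weight (eff_exponent p - 2) (2 * h1 * sqrt s) * h1)
      \<le> A * (2 * \<delta>)\<^sup>2 * ?w + B * (2 * \<delta>)"
    unfolding h1 \<gamma>_def
    by (rule growing_profile_inequality) (use eff_exponent_ge_2[OF p] \<delta>0 \<delta>1 s A B in auto)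
  also have "\<dots> \<le> A * (\<epsilon> * D)\<^sup>2 * ?w + B * (\<epsilon> * D)"
    using \<delta>D \<delta>0 A B by (intro add_mono mult_right_mono mult_left_mono power_mono) auto
  also have "\<dots> = (A * \<epsilon> * D\<^sup>2) * (\<epsilon> * ?w) + \<epsilon> * (c * K - 1)"
    using K by (simp add: power2_eq_square algebra_simps A_def B_def c_def D_def)
  also have "\<dots> \<le> c * (\<epsilon> * ?w) + \<epsilon> * (c * K - 1)"
    using \<epsilon> by (intro add_right_mono mult_right_mono) (auto simp: A_def D_def c_def)
  also have "\<dots> < c * (\<epsilon> * (?w + K))" using \<epsilon> by (simp add: algebra_simps)
  also have "\<dots> \<le> c * ht"
    using c N by (intro mult_left_mono) (auto simp: ht_def growth_height_t_def)
  finally have less: "A * (2 * h1 * sqrt s) powr eff_exponent p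
      + 2 * B * (weight (eff_exponent p - 2) (2 * h1 * sqrt s) * h1) < c * ht" .
  have "radial_Gamma TYPE('n) p s (\<mu> * E) ((\<mu> * E) * h1) ((\<mu> * E) * (h2 + h1\<^sup>2)) ((\<mu> * E) * ht) < 0"
    by (rule radial_Gamma_exp_less[OF p _ s _ h2])
      (use less \<mu> \<delta>0 in \<open>auto simp: A_def B_def c_def E_def h1\<close>)
  then show ?thesis by (simp add: mult.assoc)
qed

text \<open>The constant \<open>b\<close> is \<open>ln M\<close> in the application and may be negative; half of the room that
  \<open>o(R\<^bsup>q\<^esup>)\<close> leaves below \<open>\<epsilon> R\<^bsup>q\<^esup>\<close> is spent on it.\<close>

lemma large_radius:
  fixes p :: ereal
  assumes p: "2 \<le> p" and \<epsilon>: "0 < \<epsilon>"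
    and g: "g \<in> o[at_top](\<lambda>R. R powr growth_exponent p)"
    and ev: "\<forall>\<^sub>F R in at_top. (SUP z \<in> cball (0::real^'n::finite) R \<times> {0..<T}. ereal (u z)) \<le> ereal (exp (g R))"
  obtains R where "r < R" "1 < R"
    "\<And>x t. norm x \<le> R \<Longrightarrow> 0 \<le> t \<Longrightarrow> t < T \<Longrightarrow> u (x, t) \<le> exp (b + \<epsilon> * R powr growth_exponent p)"
proof -
  have q: "0 < growth_exponent p" using eff_exponent_ge_2[OF p] by (simp add: growth_exponent_eq_eff_exponent)
  have "\<forall>\<^sub>F R in at_top. norm (g R) \<le> \<epsilon> / 2 * norm (R powr growth_exponent p)"
    using landau_o.smallD[OF g, of "\<epsilon> / 2"] \<epsilon> by simp
  moreover have "\<forall>\<^sub>F R in at_top. - 2 * b / \<epsilon> \<le> R powr growth_exponent p"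
    using eventually_ge_at_top[of "max 1 (- 2 * b / \<epsilon>) powr (1 / growth_exponent p)"]
  proof eventually_elim
    fix R assume R: "max 1 (- 2 * b / \<epsilon>) powr (1 / growth_exponent p) \<le> R"
    have "- 2 * b / \<epsilon> \<le> (max 1 (- 2 * b / \<epsilon>) powr (1 / growth_exponent p)) powr growth_exponent p"
      using q by (simp add: powr_powr del: max.cobounded1)
    also have "\<dots> \<le> R powr growth_exponent p" using R q by (intro powr_mono2) auto
    finally show "- 2 * b / \<epsilon> \<le> R powr growth_exponent p" .
  qed
  moreover note ev eventually_gt_at_top[of r] eventually_gt_at_top[of 1]
  ultimately have "\<forall>\<^sub>F R in at_top. norm (g R) \<le> \<epsilon> / 2 * norm (R powr growth_exponent p) \<and>
      - 2 * b / \<epsilon> \<le> R powr growth_exponent p \<and>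
      (SUP z \<in> cball (0::real^'n) R \<times> {0..<T}. ereal (u z)) \<le> ereal (exp (g R)) \<and> r < R \<and> 1 < R"
    by eventually_elim auto
  then obtain R where R: "norm (g R) \<le> \<epsilon> / 2 * norm (R powr growth_exponent p)"
      "- 2 * b / \<epsilon> \<le> R powr growth_exponent p"
      "(SUP z \<in> cball (0::real^'n) R \<times> {0..<T}. ereal (u z)) \<le> ereal (exp (g R))" "r < R" "1 < R"
    by (auto dest: eventually_happens simp: trivial_limit_at_top_linorder)
  have "g R \<le> \<epsilon> / 2 * R powr growth_exponent p" using R(1) by simp
  moreover have "- b \<le> \<epsilon> / 2 * R powr growth_exponent p" using R(2) \<epsilon> by (simp add: field_simps)
  ultimately have gR: "g R \<le> b + \<epsilon> * R powr growth_exponent p" by (simp add: field_simps)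
  show ?thesis
  proof (rule that[OF R(4,5)])
    fix x :: "real^'n" and t assume "norm x \<le> R" "0 \<le> t" "t < T"
    then have "ereal (u (x, t)) \<le> (SUP z \<in> cball (0::real^'n) R \<times> {0..<T}. ereal (u z))"
      by (intro SUP_upper) auto
    then have "u (x, t) \<le> exp (g R)" using R(3) by (metis ereal_less_eq(3) order_trans)
    then show "u (x, t) \<le> exp (b + \<epsilon> * R powr growth_exponent p)"
      using gR by (meson exp_le_cancel_iff order_trans)
  qed
qed

text \<open>For fixed \<open>\<epsilon>\<close> the growth condition provides one large ball on whose lateral boundary the barrier lies
  above \<open>u\<close>. The resulting bound at \<open>(x0, t0)\<close> contains neither the radius of that ball nor the
  penalty \<open>N\<close>, both of which depend on \<open>\<epsilon>\<close>, so that \<open>\<epsilon>\<close> can tend to 0.\<close>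

lemma subsolution_upper_bound:
  fixes u :: "(real^'n::finite) \<times> real \<Rightarrow> real"
  assumes p: "2 \<le> p" and sub: "viscosity_subsolution p T u"
    and cont: "continuous_on (UNIV \<times> {0..<T}) u"
    and M: "0 < M" "\<And>x. u (x, 0) \<le> M"
    and g: "g \<in> o[at_top](\<lambda>R. R powr growth_exponent p)"
    and ev: "\<forall>\<^sub>F R in at_top. (SUP z \<in> cball 0 R \<times> {0..<T}. ereal (u z)) \<le> ereal (exp (g R))"
    and t0: "0 < t0" "t0 < T"
  shows "u (x0, t0) \<le> M"
proof -
  define b where "b = ln M"
  have b: "exp b = M" using M by (simp add: b_def)
  define D where "D = 2 * (1 + T)"
  have T: "0 < T" and D: "0 < D" using t0 by (auto simp: D_def)
  \<comment> \<open>\<open>\<epsilon> B D\<close> bounds the diffusion term; the summand 1 gives strictness.\<close>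
  define K where "K = (coeff_first TYPE('n) p * D + 1) / (eff_exponent p - 1)"
  have c: "1 \<le> eff_exponent p - 1" using eff_exponent_ge_2[OF p] by simp
  have K: "0 \<le> K" "(eff_exponent p - 1) * K = coeff_first TYPE('n) p * D + 1"
    using c D coeff_first_pos[OF p, of "TYPE('n)"] by (auto simp: K_def)
  have A: "0 < coeff_second p" by (rule coeff_second_pos[OF p])
  define \<gamma> where "\<gamma> = eff_exponent p / (eff_exponent p - 1) / 2"
  define \<tau> where "\<tau> = (t0 + T) / 2"
  have \<tau>: "t0 < \<tau>" "\<tau> < T" "0 < \<tau>" using t0 by (auto simp: \<tau>_def)
  define X where "X = (1 + t0) * (1 + x0 \<bullet> x0) powr \<gamma> + K * t0"
  have bound: "u (x0, t0) \<le> exp (b + \<epsilon> * X)"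
    if \<epsilon>: "0 < \<epsilon>" "\<epsilon> \<le> 1 / D" "\<epsilon> \<le> (eff_exponent p - 1) / (coeff_second p * D\<^sup>2)" for \<epsilon>
  proof -
    have \<epsilon>D: "\<epsilon> * D \<le> 1" using \<epsilon>(2) D by (simp add: field_simps)
    have \<epsilon>A: "coeff_second p * \<epsilon> * D\<^sup>2 \<le> eff_exponent p - 1" using \<epsilon>(3) D A by (simp add: field_simps)
    obtain R where R: "norm x0 < R" "1 < R"
      and uR: "\<And>x t. norm x \<le> R \<Longrightarrow> 0 \<le> t \<Longrightarrow> t < T \<Longrightarrow> u (x, t) \<le> exp (b + \<epsilon> * R powr growth_exponent p)"
      by (rule large_radius[OF p \<epsilon>(1) g ev, of "norm x0" b]) blast
    obtain N where N: "0 \<le> N" "\<epsilon> * R powr growth_exponent p \<le> N * (\<tau> - t0)\<^sup>2"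
      using penalty_strength[of "\<tau> - t0" "\<epsilon> * R powr growth_exponent p"] \<tau> by auto
    define H where "H = growth_height \<epsilon> \<gamma> K N t0 b"
    have Hge: "b + \<epsilon> * (1 + s) powr \<gamma> + N * (max 0 (t - t0))\<^sup>2 \<le> H s t" if "0 \<le> t" for s t
      using that \<epsilon> K by (simp add: H_def growth_height_def algebra_simps)
    have Hb: "b \<le> H s t" if "0 \<le> t" for s t
    proof -
      have "0 \<le> \<epsilon> * (1 + s) powr \<gamma>" "0 \<le> N * (max 0 (t - t0))\<^sup>2" using \<epsilon> N by auto
      then show ?thesis using Hge[OF that, of s] by linarith
    qed
    have "u (x0, t0) \<le> exp (H (x0 \<bullet> x0) t0)"
    proof (rule subsolution_below_radial_barrier[OF p sub \<tau>(2), where R = R and F = "\<lambda>s t. exp (H s t)"])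
      show "continuous_on (cball 0 R \<times> {0..\<tau>}) u"
        using \<tau> by (intro continuous_on_subset[OF cont]) auto
      show "radial_C21 (\<lambda>s t. exp (H s t))
         (\<lambda>s t. exp (H s t) * growth_height_s \<epsilon> \<gamma> s t)
         (\<lambda>s t. exp (H s t) * (growth_height_ss \<epsilon> \<gamma> s t + (growth_height_s \<epsilon> \<gamma> s t)\<^sup>2))
         (\<lambda>s t. exp (H s t) * growth_height_t \<epsilon> \<gamma> K N t0 s t)"
        unfolding H_def by (rule radial_C21_exp_growth_height)
    next
      fix \<mu> s t :: real assume "0 < \<mu>" "0 \<le> s" "s < R\<^sup>2" "0 < t" "t < \<tau>"
      then show "radial_Gamma TYPE('n) p s (\<mu> * exp (H s t)) (\<mu> * (exp (H s t) * growth_height_s \<epsilon> \<gamma> s t))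
         (\<mu> * (exp (H s t) * (growth_height_ss \<epsilon> \<gamma> s t + (growth_height_s \<epsilon> \<gamma> s t)\<^sup>2)))
         (\<mu> * (exp (H s t) * growth_height_t \<epsilon> \<gamma> K N t0 s t)) < 0"
        unfolding H_def \<gamma>_def
        by (intro growth_barrier_strict[OF p T]) (use \<epsilon> \<epsilon>D \<epsilon>A K N \<tau> in \<open>auto simp: D_def\<close>)
    next
      fix x :: "real^'n" and t assume x: "norm x = R" and t: "0 \<le> t" "t \<le> \<tau>"
      have "growth_exponent p = 2 * \<gamma>" by (simp only: growth_exponent_eq_eff_exponent \<gamma>_def field_sum_of_halves mult_2)
      then have "R powr growth_exponent p = R powr (2 * \<gamma>)" by (simp only:)
      also have "\<dots> = (R powr 2) powr \<gamma>" by (simp only: powr_powr)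
      also have "\<dots> = (R\<^sup>2) powr \<gamma>" using R by simp
      also have "\<dots> \<le> (1 + x \<bullet> x) powr \<gamma>"
        using x c by (intro powr_mono2) (auto simp: dot_square_norm \<gamma>_def)
      finally have "\<epsilon> * R powr growth_exponent p \<le> \<epsilon> * (1 + x \<bullet> x) powr \<gamma>" using \<epsilon> by simp
      moreover have "0 \<le> N * (max 0 (t - t0))\<^sup>2" using N by simp
      ultimately have "b + \<epsilon> * R powr growth_exponent p \<le> H (x \<bullet> x) t"
        using Hge[OF t(1), of "x \<bullet> x"] by linarith
      then show "u (x, t) \<le> exp (H (x \<bullet> x) t)"
        using uR[of x t] x t \<tau> by (meson exp_le_cancel_iff order_trans order_le_less_trans order_refl)
    next
      fix x :: "real^'n" assume "norm x \<le> R"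
      show "u (x, 0) \<le> exp (H (x \<bullet> x) 0)"
        using M(2)[of x] Hb[of 0 "x \<bullet> x"] b by (metis exp_le_cancel_iff order_refl order_trans)
    next
      fix x :: "real^'n" assume x: "norm x \<le> R"
      have "0 \<le> \<epsilon> * (1 + x \<bullet> x) powr \<gamma>" using \<epsilon> by simp
      then have "b + \<epsilon> * R powr growth_exponent p \<le> H (x \<bullet> x) \<tau>"
        using Hge[of \<tau> "x \<bullet> x"] N \<tau> by simp
      then show "u (x, \<tau>) \<le> exp (H (x \<bullet> x) \<tau>)"
        using uR[of x \<tau>] x \<tau> by (meson exp_le_cancel_iff order_trans less_imp_le)
    qed (use R \<tau> t0 in auto)
    also have "H (x0 \<bullet> x0) t0 = b + \<epsilon> * X"
      by (simp add: H_def growth_height_def X_def)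
    finally show ?thesis .
  qed
  have "((\<lambda>\<epsilon>. exp (b + \<epsilon> * X)) \<longlongrightarrow> exp (b + 0 * X)) (at_right 0)" by (intro tendsto_intros)
  moreover have "\<forall>\<^sub>F \<epsilon> in at_right 0. u (x0, t0) \<le> exp (b + \<epsilon> * X)"
  proof -
    have "0 < min (1 / D) ((eff_exponent p - 1) / (coeff_second p * D\<^sup>2))" using D A c by simp
    from eventually_at_right_real[OF this] show ?thesis
      by eventually_elim (auto intro!: bound)
  qed
  ultimately have "u (x0, t0) \<le> exp (b + 0 * X)"
    by (rule tendsto_lowerbound) simp
  then show ?thesis by (simp add: b)
qed

section \<open>The lower bound\<close>

lemma radial_C21_bump:
  fixes R \<Lambda> N t0 m :: real
  assumes "R \<noteq> 0"
  defines "E \<equiv> \<lambda>t. m * exp (- (\<Lambda> * t + N * (max 0 (t - t0))\<^sup>2))"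
  shows "radial_C21 (\<lambda>s t. E t * (1 - s / R\<^sup>2)\<^sup>2)
     (\<lambda>s t. - (2 * E t / R\<^sup>2 * (1 - s / R\<^sup>2)))
     (\<lambda>s t. 2 * E t / R^4)
     (\<lambda>s t. - ((\<Lambda> + 2 * N * max 0 (t - t0)) * (E t * (1 - s / R\<^sup>2)\<^sup>2)))"
proof -
  have E: "(E has_field_derivative - ((\<Lambda> + 2 * N * max 0 (t - t0)) * E t)) (at t)" for t
    unfolding E_def
    by (rule derivative_eq_intros DERIV_time_penalty refl)+ (simp add: algebra_simps)
  have cE: "continuous_on S (\<lambda>z. E (h z))" if "continuous_on S h" for S and h :: "real \<times> real \<Rightarrow> real"
    unfolding E_def by (intro continuous_intros that)
  have R4: "2 * E t / R^4 = - (2 * E t / R\<^sup>2) * - (1 / R\<^sup>2)" for t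
    using \<open>R \<noteq> 0\<close> by (simp add: power2_eq_square power4_eq_xxxx)
  have lin: "((\<lambda>s. 1 - s / R\<^sup>2) has_field_derivative - (1 / R\<^sup>2)) (at s)" for s
    using DERIV_diff[OF DERIV_const[of 1] DERIV_cdivide[OF DERIV_ident, of "R\<^sup>2"], of s] by simp
  have 1: "((\<lambda>s. E t * (1 - s / R\<^sup>2)\<^sup>2) has_field_derivative - (2 * E t / R\<^sup>2 * (1 - s / R\<^sup>2))) (at s)" for s t
    using DERIV_cmult[OF DERIV_power[OF lin, of 2], of "E t" s] by (simp add: mult_ac)
  have 2: "((\<lambda>s. - (2 * E t / R\<^sup>2 * (1 - s / R\<^sup>2))) has_field_derivative 2 * E t / R^4) (at s)" for s t
    using DERIV_cmult[OF lin, of "- (2 * E t / R\<^sup>2)" s] unfolding R4 by simp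
  have 3: "((\<lambda>t. E t * (1 - s / R\<^sup>2)\<^sup>2) has_field_derivative
      - ((\<Lambda> + 2 * N * max 0 (t - t0)) * (E t * (1 - s / R\<^sup>2)\<^sup>2))) (at t)" for s t
    using DERIV_cmult_right[OF E[of t], of "(1 - s / R\<^sup>2)\<^sup>2"] by (simp add: algebra_simps)
  show ?thesis
    unfolding radial_C21_def using 1 2 3
    by (auto simp: case_prod_beta assms intro!: continuous_intros cE)
qed

text \<open>The bump vanishes on the lateral boundary, where positivity of \<open>u\<close> puts it below \<open>u\<close>. As \<open>R\<close>
  tends to infinity, the bump tends to 1 at \<open>x0\<close> and its decay rate \<open>K/R\<^sup>2\<close>
  tends to 0.\<close>

lemma supersolution_lower_bound:
  fixes u :: "(real^'n::finite) \<times> real \<Rightarrow> real"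
  assumes p: "2 \<le> p" and super: "viscosity_supersolution p T u"
    and cont: "continuous_on (UNIV \<times> {0..<T}) u"
    and upos: "\<forall>z \<in> UNIV \<times> {0..<T}. 0 < u z"
    and m: "0 < m" "\<And>x. m \<le> u (x, 0)"
    and t0: "0 < t0" "t0 < T"
  shows "m \<le> u (x0, t0)"
proof -
  define B where "B = coeff_first TYPE('n) p"
  have B: "0 < B" using coeff_first_pos[OF p] by (simp add: B_def)
  define K where "K = 8 * B / (2 * coeff_second p / (2 * coeff_second p + B)) powr (2 * eff_exponent p - 2)"
  have K: "0 \<le> K" using B coeff_second_pos[OF p] by (simp add: K_def)
  define \<tau> where "\<tau> = (t0 + T) / 2"
  have \<tau>: "t0 < \<tau>" "\<tau> < T" "0 < \<tau>" using t0 by (auto simp: \<tau>_def)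
  have bound: "m * exp (- (K / R\<^sup>2 * t0)) * (1 - (x0 \<bullet> x0) / R\<^sup>2)\<^sup>2 \<le> u (x0, t0)"
    if R: "4 \<le> R" "norm x0 \<le> R" for R
  proof -
    have contR: "continuous_on (cball 0 R \<times> {0..\<tau>}) u"
      using \<tau> by (intro continuous_on_subset[OF cont]) auto
    have "\<exists>z\<in>cball 0 R \<times> {0..\<tau>}. \<forall>w\<in>cball 0 R \<times> {0..\<tau>}. u z \<le> u w"
      using R \<tau> by (intro continuous_attains_inf contR compact_Times) auto
    then obtain z where z: "z \<in> cball 0 R \<times> {0..\<tau>}" "\<And>w. w \<in> cball 0 R \<times> {0..\<tau>} \<Longrightarrow> u z \<le> u w"
      by blast
    have uz: "0 < u z" using z(1) \<tau> by (intro upos[rule_format]) auto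
    \<comment> \<open>The minimum of \<open>u\<close> over the compact cylinder fixes how far the bump must have decayed at \<open>\<tau>\<close>.\<close>
    obtain N where N: "0 \<le> N" "ln (m / u z) \<le> N * (\<tau> - t0)\<^sup>2"
      using penalty_strength[of "\<tau> - t0" "ln (m / u z)"] \<tau> by auto
    define E where "E = (\<lambda>t. m * exp (- (K / R\<^sup>2 * t + N * (max 0 (t - t0))\<^sup>2)))"
    have E: "0 < E t" for t using m by (simp add: E_def)
    have sq: "(1 - (x \<bullet> x) / R\<^sup>2)\<^sup>2 \<le> 1" if "norm x \<le> R" for x :: "real^'n"
    proof -
      have "x \<bullet> x \<le> R\<^sup>2" using that by (simp add: dot_square_norm power_mono)
      then have "0 \<le> 1 - (x \<bullet> x) / R\<^sup>2" "1 - (x \<bullet> x) / R\<^sup>2 \<le> 1" using R by (auto simp: field_simps)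
      then show ?thesis by (simp add: power_le_one)
    qed
    have below: "E t * (1 - (x \<bullet> x) / R\<^sup>2)\<^sup>2 \<le> E t" if "norm x \<le> R" for x :: "real^'n" and t
      using mult_left_mono[OF sq[OF that], of "E t"] E[of t] by simp
    have "E t0 * (1 - (x0 \<bullet> x0) / R\<^sup>2)\<^sup>2 \<le> u (x0, t0)"
    proof (rule supersolution_above_radial_barrier[OF p super \<tau>(2) contR,
          where F = "\<lambda>s t. E t * (1 - s / R\<^sup>2)\<^sup>2"])
      show "radial_C21 (\<lambda>s t. E t * (1 - s / R\<^sup>2)\<^sup>2) (\<lambda>s t. - (2 * E t / R\<^sup>2 * (1 - s / R\<^sup>2)))
         (\<lambda>s t. 2 * E t / R^4)
         (\<lambda>s t. - ((K / R\<^sup>2 + 2 * N * max 0 (t - t0)) * (E t * (1 - s / R\<^sup>2)\<^sup>2)))"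
        unfolding E_def using R by (intro radial_C21_bump) auto
    next
      fix \<mu> s t :: real assume \<mu>: "0 < \<mu>" and s: "0 \<le> s" "s < R\<^sup>2" and "0 < t" "t < \<tau>"
      have "K / R\<^sup>2 \<le> K / R\<^sup>2 + 2 * N * max 0 (t - t0)" using N by simp
      from radial_Gamma_bump_pos[OF p R(1) s, where E = "\<mu> * E t" and n = "TYPE('n)", OF _ this[unfolded K_def B_def]]
      show "0 < radial_Gamma TYPE('n) p s (\<mu> * (E t * (1 - s / R\<^sup>2)\<^sup>2))
          (\<mu> * - (2 * E t / R\<^sup>2 * (1 - s / R\<^sup>2))) (\<mu> * (2 * E t / R^4))
          (\<mu> * - ((K / R\<^sup>2 + 2 * N * max 0 (t - t0)) * (E t * (1 - s / R\<^sup>2)\<^sup>2)))"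
        using \<mu> E[of t] B by (simp add: B_def K_def mult_ac)
    next
      fix x :: "real^'n" and t assume x: "norm x = R" and t: "0 \<le> t" "t \<le> \<tau>"
      have "(x \<bullet> x) / R\<^sup>2 = 1" using x R by (simp add: dot_square_norm)
      then have "E t * (1 - (x \<bullet> x) / R\<^sup>2)\<^sup>2 = 0" by (simp only: diff_self power_zero_numeral mult_zero_right)
      moreover have "0 < u (x, t)" using upos[rule_format, of "(x, t)"] t \<tau> by simp
      ultimately show "E t * (1 - (x \<bullet> x) / R\<^sup>2)\<^sup>2 \<le> u (x, t)" by linarith
    next
      fix x :: "real^'n" assume x: "norm x \<le> R"
      have "E 0 \<le> m" using t0 by (simp add: E_def)
      then show "E 0 * (1 - (x \<bullet> x) / R\<^sup>2)\<^sup>2 \<le> u (x, 0)" using below[OF x, of 0] m(2)[of x] by linarith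
    next
      fix x :: "real^'n" assume x: "norm x \<le> R"
      have "0 \<le> K / R\<^sup>2 * \<tau>" using K \<tau> by simp
      then have "E \<tau> \<le> m * exp (- ln (m / u z))"
        using N \<tau> m by (simp add: E_def)
      also have "\<dots> = u z" using m uz by (simp add: exp_minus)
      also have "\<dots> \<le> u (x, \<tau>)" using x \<tau> by (intro z(2)) auto
      finally show "E \<tau> * (1 - (x \<bullet> x) / R\<^sup>2)\<^sup>2 \<le> u (x, \<tau>)" using below[OF x, of \<tau>] by linarith
    qed (use R t0 \<tau> upos in auto)
    then show ?thesis by (simp add: E_def)
  qed
  have "((\<lambda>R :: real. 1 / R\<^sup>2) \<longlongrightarrow> 0) at_top"
    by (intro tendsto_divide_0[OF tendsto_const] filterlim_at_top_imp_at_infinity filterlim_pow_at_top filterlim_ident) simp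
  then have "((\<lambda>R :: real. m * exp (- (K * (1 / R\<^sup>2) * t0)) * (1 - (x0 \<bullet> x0) * (1 / R\<^sup>2))\<^sup>2)
      \<longlongrightarrow> m * exp (- (K * 0 * t0)) * (1 - (x0 \<bullet> x0) * 0)\<^sup>2) at_top"
    by (intro tendsto_intros)
  moreover have "\<forall>\<^sub>F R in at_top. m * exp (- (K * (1 / R\<^sup>2) * t0)) * (1 - (x0 \<bullet> x0) * (1 / R\<^sup>2))\<^sup>2 \<le> u (x0, t0)"
    using eventually_ge_at_top[of 4] eventually_ge_at_top[of "norm x0"]
    by eventually_elim (use bound in simp)
  ultimately have "m * exp (- (K * 0 * t0)) * (1 - (x0 \<bullet> x0) * 0)\<^sup>2 \<le> u (x0, t0)"
    by (rule tendsto_upperbound) simp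
  then show ?thesis by simp
qed

theorem theorem1p3:
  fixes p :: ereal and T :: real
    and f :: "real^'n::finite \<Rightarrow> real"
    and u :: "(real^'n) \<times> real \<Rightarrow> real"
  assumes "2 \<le> p"
    and "CARD('n) \<ge> 2"
    and "0 < T"
    and "bdd_below (range f)" and "0 < (INF x. f x)"
    and "bdd_above (range f)"
    and "continuous_on (UNIV \<times> {0..<T}) u"
    and "\<forall>z \<in> UNIV \<times> {0..<T}. 0 < u z"
    and "viscosity_solution p T u"
    and "\<forall>x. u (x, 0) = f x"
    and "\<exists>g :: real \<Rightarrow> real. g \<in> o[at_top](\<lambda>R. R powr growth_exponent p) \<and>
           (\<forall>\<^sub>F R in at_top. (SUP z \<in> cball 0 R \<times> {0..<T}. ereal (u z)) \<le> ereal (exp (g R)))"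
  shows "\<forall>x. \<forall>t\<in>{0<..<T}. (INF y. f y) \<le> u (x, t) \<and> u (x, t) \<le> (SUP y. f y)"
proof (intro allI ballI conjI)
  fix x :: "real^'n" and t assume t: "t \<in> {0<..<T}"
  from \<open>viscosity_solution p T u\<close>
  have sub: "viscosity_subsolution p T u" and super: "viscosity_supersolution p T u"
    by (auto simp: viscosity_solution_def)
  have inf: "(INF y. f y) \<le> u (x, 0)" for x
    using cINF_lower[OF \<open>bdd_below (range f)\<close>, of x] \<open>\<forall>x. u (x, 0) = f x\<close> by simp
  have sup: "u (x, 0) \<le> (SUP y. f y)" for x
    using cSUP_upper[OF _ \<open>bdd_above (range f)\<close>, of x] \<open>\<forall>x. u (x, 0) = f x\<close> by simp
  show "(INF y. f y) \<le> u (x, t)"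
    by (rule supersolution_lower_bound[OF \<open>2 \<le> p\<close> super]) (use assms inf t in auto)
  have "0 < (SUP y. f y)"
    using \<open>0 < (INF x. f x)\<close> inf[of x] sup[of x] by linarith
  then show "u (x, t) \<le> (SUP y. f y)"
    using assms(11) subsolution_upper_bound[OF \<open>2 \<le> p\<close> sub \<open>continuous_on (UNIV \<times> {0..<T}) u\<close>] sup t
    by (auto simp del: split_paired_All)
qed

end
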